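(* Let $g\neq 0$ be a real $M_1\times M_2$ matrix with singular value decomposition $g=VSW^T$, let $d$ be the multiplicity of its largest singular value $\|g\|_2$, and let $V^d$, $W^d$ be as defined in the context. Let $d'\in\{1,\dots,d\}$. The following are equivalent: (a) there exist unit vectors $\vec v_1,\dots,\vec v_{M_1},\vec w_1,\dots,\vec w_{M_2}\in\mathbb R^{d'}$ with $\sum_{i,j} g_{i,j}\,\vec v_i^T\vec w_j=\sqrt{M_1M_2}\,\|g\|_2$; (b) there exists a real $d\times d'$ matrix $\alpha$ with $$\|\alpha^T V^d_{i,*}\|^2=1\ \ \forall i\in\{1,\dots,M_1\},\qquad \|\alpha^T W^d_{j,*}\|^2=\tfrac{M_1}{M_2}\ \ \forall j\in\{1,\dots,M_2\}.$$ Moreover, if $\alpha$ satisfies (b), then $\vec v_i=\alpha^TV^d_{i,*}$ and $\vec w_j=\sqrt{M_2/M_1}\,\alpha^TW^d_{j,*}$ are unit vectors satisfying (a). Consequently, the bound $\sum_{x_1,x_2} g_{x_1,x_2}E(x_1,x_2)\le\sqrt{M_1M_2}\|g\|_2$ is attained with equality by some finite-dimensional Hilbert spaces $\mathcal H_1,\mathcal H_2$, state $\rho$ and observables $\mathcal A_i(x_i)$ (as in the context) if and only if the system in (b) has a real solution $\alpha$ of size $d\times d'$ for some $d'\le d$; in that case an optimal quantum strategy exists with $E(x_1,x_2)=\vec v_{x_1}^T\vec w_{x_2}$ for the vectors above.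
   Context: Bipartite setting: party $i\in\{1,2\}$ has a finite-dimensional complex Hilbert space $\mathcal H_i$ and $M_i$ observables $\mathcal A_i(x_i)$, $x_i=1,\dots,M_i$, which are Hermitian operators on $\mathcal H_i$ with all eigenvalues in $[-1,1]$; $\rho$ is a density operator on $\mathcal H_1\otimes\mathcal H_2$ and $E(x_1,x_2)=\operatorname{tr}(\rho\,\mathcal A_1(x_1)\otimes\mathcal A_2(x_2))$. $\|g\|_2$ is the largest singular value of $g$. Singular value decomposition: $V$ is an orthogonal $M_1\times M_1$ matrix, $W$ an orthogonal $M_2\times M_2$ matrix and $S$ a diagonal $M_1\times M_2$ matrix with nonnegative nonincreasing diagonal entries, $g=VSW^T$. $V^d$ (resp. $W^d$) is the $M_1\times d$ (resp. $M_2\times d$) matrix formed by the first $d$ columns of $V$ (resp. $W$). For a matrix $A$, $A_{i,*}$ denotes the $i$-th row of $A$ written as a column vector. *)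

theory Defs
  imports Complex_Main "Jordan_Normal_Form.Matrix" "Jordan_Normal_Form.Char_Poly"
begin

definition mtrace :: "'a::comm_monoid_add mat \<Rightarrow> 'a" where
  "mtrace A = (\<Sum>i<dim_row A. A $$ (i, i))"

definition kron :: "'a::times mat \<Rightarrow> 'a mat \<Rightarrow> 'a mat" where
  "kron A B = mat (dim_row A * dim_row B) (dim_col A * dim_col B)
     (\<lambda>(i, j). A $$ (i div dim_row B, j div dim_col B) * B $$ (i mod dim_row B, j mod dim_col B))"

definition hermitian_mat :: "nat \<Rightarrow> complex mat \<Rightarrow> bool" where
  "hermitian_mat n A \<longleftrightarrow> A \<in> carrier_mat n n \<and>
     (\<forall>i<n. \<forall>j<n. A $$ (i, j) = cnj (A $$ (j, i)))"

definition observable :: "nat \<Rightarrow> complex mat \<Rightarrow> bool" where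
  "observable n A \<longleftrightarrow> hermitian_mat n A \<and>
     (\<forall>k. eigenvalue A k \<longrightarrow> (\<exists>r::real. k = complex_of_real r \<and> -1 \<le> r \<and> r \<le> 1))"

definition density_op :: "nat \<Rightarrow> complex mat \<Rightarrow> bool" where
  "density_op n \<rho> \<longleftrightarrow> hermitian_mat n \<rho> \<and>
     (\<forall>v \<in> carrier_vec n. 0 \<le> Re (\<Sum>i<n. cnj (v $ i) * (\<rho> *\<^sub>v v) $ i)) \<and>
     mtrace \<rho> = 1"

definition correlator :: "complex mat \<Rightarrow> complex mat \<Rightarrow> complex mat \<Rightarrow> complex" where
  "correlator \<rho> A B = mtrace (\<rho> * kron A B)"

definition quantum_strategy ::
  "nat \<Rightarrow> nat \<Rightarrow> nat \<Rightarrow> nat \<Rightarrow> complex mat \<Rightarrow> (nat \<Rightarrow> complex mat) \<Rightarrow> (nat \<Rightarrow> complex mat) \<Rightarrow> bool" where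
  "quantum_strategy M1 M2 n1 n2 \<rho> A1 A2 \<longleftrightarrow>
     (\<forall>x<M1. observable n1 (A1 x)) \<and> (\<forall>x<M2. observable n2 (A2 x)) \<and> density_op (n1 * n2) \<rho>"

end

theory Submission
  imports Defs "HOL-Real_Asymp.Real_Asymp" "Jordan_Normal_Form.Spectral_Radius"
begin

text \<open>
  Write \<open>p\<^sub>k = \<Sum>\<^sub>i V\<^sub>i\<^sub>k v\<^sub>i\<close>, \<open>q\<^sub>k = \<Sum>\<^sub>j W\<^sub>j\<^sub>k w\<^sub>j\<close> and \<open>c = sqrt (M\<^sub>2 / M\<^sub>1)\<close>.
  The correlation sum is \<open>\<Sum>\<^sub>k s\<^sub>k (p\<^sub>k \<bullet> q\<^sub>k)\<close>, while \<open>\<Sum>\<^sub>k \<bar>p\<^sub>k\<bar>\<^sup>2 = M\<^sub>1\<close> and \<open>\<Sum>\<^sub>k \<bar>q\<^sub>k\<bar>\<^sup>2 = M\<^sub>2\<close>.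
  The AM-GM inequality \<open>2 (p \<bullet> q) \<le> c \<bar>p\<bar>\<^sup>2 + \<bar>q\<bar>\<^sup>2 / c\<close> gives the bound, with equality only if
  \<open>p\<^sub>k = 0\<close> and \<open>q\<^sub>k = 0\<close> for \<open>k \<ge> d\<close> and \<open>q\<^sub>k = c p\<^sub>k\<close> for \<open>k < d\<close>; the rows of \<open>\<alpha>\<close> are the
  vectors \<open>p\<^sub>k\<close>.
  A quantum strategy yields vectors of norm at most 1: factor \<open>\<rho> = \<Sum>\<^sub>t \<phi>\<^sub>t \<phi>\<^sub>t\<^sup>*\<close> and stack
  \<open>(A \<otimes> 1) \<phi>\<^sub>t\<close> and \<open>(1 \<otimes> B) \<phi>\<^sub>t\<close> over \<open>t\<close>. Their dimension is too large, but only the Gram matrix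
  of the \<open>p\<^sub>k\<close> with \<open>k < d\<close> matters. Conversely, unit vectors are realised by Clifford matrices acting on a
  maximally entangled state.
\<close>

section \<open>Factorization of positive semidefinite kernels\<close>

definition psd_on :: "'a set \<Rightarrow> ('a \<Rightarrow> 'a \<Rightarrow> real) \<Rightarrow> bool" where
  "psd_on I G \<longleftrightarrow> (\<forall>i\<in>I. \<forall>j\<in>I. G i j = G j i) \<and>
     (\<forall>x. 0 \<le> (\<Sum>i\<in>I. \<Sum>j\<in>I. x i * x j * G i j))"

text \<open>A zero diagonal entry at \<open>e\<close> makes the quadratic form affine in the
  coordinate at \<open>e\<close>, so a nonzero cross entry would let it become negative. This
  handles the zero pivot in the factorization below.\<close>

lemma psd_on_insert_zero:
  assumes "finite I" "e \<notin> I" and G: "psd_on (insert e I) G" and i: "i \<in> I" and e0: "G e e = 0"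
  shows "G e i = 0"
proof (rule ccontr)
  assume n: "G e i \<noteq> 0"
  \<comment> \<open>\<open>s\<close> solves \<open>2 * s * G e i + G i i = -1\<close>.\<close>
  define s where "s = - (G i i + 1) / (2 * G e i)"
  define x where "x = (\<lambda>k. if k = e then s else if k = i then 1 else 0)"
  have ei: "e \<noteq> i" using i assms(2) by auto
  have sym: "G i e = G e i" using G i unfolding psd_on_def by blast
  have "(\<Sum>k\<in>insert e I. \<Sum>j\<in>insert e I. x k * x j * G k j)
      = (\<Sum>k\<in>{e,i}. \<Sum>j\<in>insert e I. x k * x j * G k j)"
    using assms i by (intro sum.mono_neutral_right) (auto simp: x_def)
  also have "\<dots> = (\<Sum>k\<in>{e,i}. \<Sum>j\<in>{e,i}. x k * x j * G k j)"
    using assms i by (intro sum.cong refl sum.mono_neutral_right) (auto simp: x_def)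
  also have "\<dots> = 2 * s * G e i + G i i"
    using ei sym e0 by (simp add: x_def)
  also have "\<dots> = -1" using n by (simp add: s_def field_simps)
  finally have "(\<Sum>k\<in>insert e I. \<Sum>j\<in>insert e I. x k * x j * G k j) = -1" .
  moreover have "0 \<le> (\<Sum>k\<in>insert e I. \<Sum>j\<in>insert e I. x k * x j * G k j)"
    using G unfolding psd_on_def by blast
  ultimately show False by simp
qed

text \<open>Minimizing the quadratic form over the coordinate at \<open>e\<close> leaves the form of
  the Schur complement on \<open>I\<close>, which therefore inherits nonnegativity.\<close>

lemma psd_on_schur_complement:
  assumes I: "finite I" "e \<notin> I" and G: "psd_on (insert e I) G"
  shows "psd_on I (\<lambda>i j. G i j - G e i * G e j / G e e)"
  unfolding psd_on_def
proof (intro conjI allI ballI)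
  fix i j assume "i \<in> I" "j \<in> I"
  then have "G i j = G j i" using G unfolding psd_on_def by blast
  then show "G i j - G e i * G e j / G e e = G j i - G e j * G e i / G e e" by simp
next
  fix x :: "'a \<Rightarrow> real"
  define L where "L = (\<Sum>i\<in>I. x i * G e i)"
  define Q where "Q = (\<Sum>i\<in>I. \<Sum>j\<in>I. x i * x j * G i j)"
  \<comment> \<open>The minimizer in the coordinate at \<open>e\<close>. For a zero pivot, division
    by zero makes both this value and the subtracted term 0.\<close>
  define y where "y = x(e := - L / G e e)"
  have sym: "G i e = G e i" if "i \<in> I" for i using G that unfolding psd_on_def by blast
  have ye: "y i = x i" if "i \<in> I" for i using that I by (auto simp: y_def)
  have LL: "(\<Sum>i\<in>I. \<Sum>j\<in>I. x i * x j * (G e i * G e j / G e e)) = L * L / G e e"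
    unfolding L_def sum_product sum_divide_distrib
    by (intro sum.cong refl) (simp add: field_simps)
  have "0 \<le> (\<Sum>i\<in>insert e I. \<Sum>j\<in>insert e I. y i * y j * G i j)"
    using G unfolding psd_on_def by blast
  also have "\<dots> = y e * y e * G e e + (\<Sum>j\<in>I. y e * x j * G e j)
       + (\<Sum>i\<in>I. x i * y e * G e i + (\<Sum>j\<in>I. x i * x j * G i j))"
    using I by (simp add: ye sym cong: sum.cong)
  also have "\<dots> = y e * y e * G e e + 2 * y e * L + Q"
    by (simp add: sum.distrib L_def Q_def sum_distrib_left algebra_simps)
  also have "\<dots> = Q - L * L / G e e"
    by (cases "G e e = 0") (simp_all add: y_def field_simps)
  also have "\<dots> = (\<Sum>i\<in>I. \<Sum>j\<in>I. x i * x j * (G i j - G e i * G e j / G e e))"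
    unfolding right_diff_distrib sum_subtractf LL Q_def by simp
  finally show "0 \<le> (\<Sum>i\<in>I. \<Sum>j\<in>I. x i * x j * (G i j - G e i * G e j / G e e))" .
qed

text \<open>Cholesky factorization, eliminating the new index through its Schur complement. The
  columns are indexed by \<open>I\<close> itself, so the factor is square; this is what later brings
  the dimension down to \<open>d\<close>.\<close>

lemma psd_on_factorization:
  assumes "finite I" "psd_on I G"
  shows "\<exists>\<alpha>. \<forall>i\<in>I. \<forall>j\<in>I. G i j = (\<Sum>t\<in>I. \<alpha> i t * \<alpha> j t)"
  using assms
proof (induction I arbitrary: G rule: finite_induct)
  case empty
  then show ?case by simp
next
  case (insert e I)
  let ?H = "\<lambda>i j. G i j - G e i * G e j / G e e"
  obtain \<beta> where \<beta>: "\<forall>i\<in>I. \<forall>j\<in>I. ?H i j = (\<Sum>t\<in>I. \<beta> i t * \<beta> j t)"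
    using insert.IH[OF psd_on_schur_complement[OF insert.hyps insert.prems]] by blast
  define a where "a = G e e"
  have sym: "G i j = G j i" if "i \<in> insert e I" "j \<in> insert e I" for i j
    using insert.prems that unfolding psd_on_def by blast
  have a: "0 \<le> a"
  proof -
    define x where "x = (\<lambda>k. if k = e then 1 else 0 :: real)"
    have "0 \<le> (\<Sum>i\<in>insert e I. \<Sum>j\<in>insert e I. x i * x j * G i j)"
      using insert.prems unfolding psd_on_def by blast
    also have "\<dots> = (\<Sum>i\<in>{e}. \<Sum>j\<in>insert e I. x i * x j * G i j)"
      using insert.hyps by (intro sum.mono_neutral_right) (auto simp: x_def)
    also have "\<dots> = (\<Sum>i\<in>{e}. \<Sum>j\<in>{e}. x i * x j * G i j)"
      using insert.hyps by (intro sum.cong refl sum.mono_neutral_right) (auto simp: x_def)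
    finally show ?thesis by (simp add: a_def x_def)
  qed
  have zero: "G e i = 0" if "a = 0" "i \<in> I" for i
    using psd_on_insert_zero[OF insert.hyps insert.prems that(2)] that(1) by (simp add: a_def)
  \<comment> \<open>Column \<open>e\<close> holds the pivot row divided by \<open>sqrt a\<close>,
    row \<open>e\<close> is zero in the other columns, and the remaining block factors the Schur
    complement. If \<open>a = 0\<close> this column vanishes, and \<open>zero\<close> says the same
    of the entries \<open>G e i\<close> that it has to reproduce.\<close>
  define \<alpha> where "\<alpha> = (\<lambda>i t. if t = e then (if i = e then sqrt a else G e i / sqrt a)
     else if i = e then 0 else \<beta> i t)"
  have split: "(\<Sum>t\<in>insert e I. \<alpha> i t * \<alpha> j t) = \<alpha> i e * \<alpha> j e + (\<Sum>t\<in>I. \<alpha> i t * \<alpha> j t)" for i j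
    using insert.hyps by simp
  have off: "\<alpha> i t = \<beta> i t" if "i \<in> I" "t \<in> I" for i t
    using that insert.hyps by (auto simp: \<alpha>_def)
  have offe: "\<alpha> e t = 0" if "t \<in> I" for t
    using that insert.hyps by (auto simp: \<alpha>_def)
  have ne: "i \<noteq> e" if "i \<in> I" for i using that insert.hyps by auto
  have cross: "G e i = sqrt a * (G e i / sqrt a)" if "i \<in> I" for i
    using zero[OF _ that] a by (cases "a = 0") auto
  have "G i j = (\<Sum>t\<in>insert e I. \<alpha> i t * \<alpha> j t)" if ij: "i \<in> insert e I" "j \<in> insert e I" for i j
  proof -
    consider "i = e" "j = e" | "i = e" "j \<in> I" | "i \<in> I" "j = e" | "i \<in> I" "j \<in> I"
      using ij by auto
    then show ?thesis
    proof cases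
      case 1
      then show ?thesis unfolding split using a by (simp add: offe) (simp add: \<alpha>_def a_def)
    next
      case 2
      then show ?thesis unfolding split using cross[of j] ne[of j] by (simp add: offe) (simp add: \<alpha>_def)
    next
      case 3
      then show ?thesis unfolding split using cross[of i] ne[of i] sym[of e i]
        by (simp add: offe) (simp add: \<alpha>_def mult.commute)
    next
      case 4
      have "G i j = G e i / sqrt a * (G e j / sqrt a) + ?H i j"
        using a by (simp add: a_def[symmetric])
      also have "\<dots> = \<alpha> i e * \<alpha> j e + (\<Sum>t\<in>I. \<alpha> i t * \<alpha> j t)"
        using 4 \<beta> ne by (simp add: off cong: sum.cong) (simp add: \<alpha>_def)
      finally show ?thesis unfolding split .
    qed
  qed
  then show ?case by blast
qed

lemma psd_on_gram:
  fixes p :: "'a \<Rightarrow> 'b \<Rightarrow> real"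
  shows "psd_on I (\<lambda>k l. \<Sum>\<tau>\<in>T. p k \<tau> * p l \<tau>)"
  unfolding psd_on_def
proof (intro conjI allI ballI)
  fix x :: "'a \<Rightarrow> real"
  have "(\<Sum>i\<in>I. \<Sum>j\<in>I. x i * x j * (\<Sum>\<tau>\<in>T. p i \<tau> * p j \<tau>))
      = (\<Sum>i\<in>I. \<Sum>j\<in>I. \<Sum>\<tau>\<in>T. (x i * p i \<tau>) * (x j * p j \<tau>))"
    unfolding sum_distrib_left by (intro sum.cong refl) (simp add: mult_ac)
  also have "\<dots> = (\<Sum>i\<in>I. \<Sum>\<tau>\<in>T. \<Sum>j\<in>I. (x i * p i \<tau>) * (x j * p j \<tau>))"
    by (intro sum.cong refl sum.swap)
  also have "\<dots> = (\<Sum>\<tau>\<in>T. \<Sum>i\<in>I. \<Sum>j\<in>I. (x i * p i \<tau>) * (x j * p j \<tau>))"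
    by (rule sum.swap)
  also have "\<dots> = (\<Sum>\<tau>\<in>T. (\<Sum>i\<in>I. x i * p i \<tau>)\<^sup>2)"
    unfolding power2_eq_square sum_product ..
  finally show "0 \<le> (\<Sum>i\<in>I. \<Sum>j\<in>I. x i * x j * (\<Sum>\<tau>\<in>T. p i \<tau> * p j \<tau>))"
    by (simp add: sum_nonneg)
qed (simp only: mult.commute)

section \<open>The equality case of the singular value bound\<close>

text \<open>Expansion of \<open>x\<close> in an orthonormal basis. With \<open>V\<close> a function
  rather than a matrix, exchanging its arguments yields the version for orthonormal columns.\<close>

lemma orthogonal_rows_expansion:
  fixes V :: "nat \<Rightarrow> nat \<Rightarrow> real"
  assumes "\<And>i i'. i < n \<Longrightarrow> i' < n \<Longrightarrow> (\<Sum>k<n. V i k * V i' k) = (if i = i' then 1 else 0)"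
    and i: "i < n"
  shows "(\<Sum>k<n. V i k * (\<Sum>i'<n. V i' k * x i')) = x i"
proof -
  have "(\<Sum>k<n. V i k * (\<Sum>i'<n. V i' k * x i')) = (\<Sum>k<n. \<Sum>i'<n. x i' * (V i k * V i' k))"
    unfolding sum_distrib_left by (intro sum.cong refl) (simp add: mult_ac)
  also have "\<dots> = (\<Sum>i'<n. x i' * (\<Sum>k<n. V i k * V i' k))"
    unfolding sum_distrib_left by (rule sum.swap)
  also have "\<dots> = (\<Sum>i'<n. if i' = i then x i' else 0)"
    using assms by (intro sum.cong refl) auto
  also have "\<dots> = x i" using i by simp
  finally show ?thesis .
qed

lemma orthogonal_rows_parseval:
  fixes V :: "nat \<Rightarrow> nat \<Rightarrow> real"
  assumes "\<And>i i'. i < n \<Longrightarrow> i' < n \<Longrightarrow> (\<Sum>k<n. V i k * V i' k) = (if i = i' then 1 else 0)"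
  shows "(\<Sum>k<n. (\<Sum>i<n. V i k * x i)\<^sup>2) = (\<Sum>i<n. (x i)\<^sup>2)"
proof -
  have "(\<Sum>k<n. (\<Sum>i<n. V i k * x i)\<^sup>2) = (\<Sum>k<n. \<Sum>i<n. x i * (V i k * (\<Sum>i'<n. V i' k * x i')))"
    unfolding power2_eq_square sum_distrib_right by (intro sum.cong refl) (simp add: mult_ac)
  also have "\<dots> = (\<Sum>i<n. x i * (\<Sum>k<n. V i k * (\<Sum>i'<n. V i' k * x i')))"
    unfolding sum_distrib_left[where r = "x _"] by (rule sum.swap)
  also have "\<dots> = (\<Sum>i<n. (x i)\<^sup>2)"
    using orthogonal_rows_expansion[OF assms] by (intro sum.cong refl) (simp add: power2_eq_square)
  finally show ?thesis .
qed

text \<open>The singular value decomposition in coordinates. Extending \<open>s\<close> by 0 beyond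
  \<open>min M1 M2\<close> lets sums over \<open>M1\<close> and over \<open>M2\<close> use the same
  sequence, and makes every index from \<open>d\<close> on count as strictly below the top
  value.\<close>

locale svd =
  fixes M1 M2 d :: nat and V W g :: "nat \<Rightarrow> nat \<Rightarrow> real" and s :: "nat \<Rightarrow> real" and \<sigma> :: real
  assumes M1: "0 < M1" and M2: "0 < M2" and \<sigma>: "0 < \<sigma>"
    and V_rows: "\<And>i i'. i < M1 \<Longrightarrow> i' < M1 \<Longrightarrow> (\<Sum>k<M1. V i k * V i' k) = (if i = i' then 1 else 0)"
    and V_cols: "\<And>k k'. k < M1 \<Longrightarrow> k' < M1 \<Longrightarrow> (\<Sum>i<M1. V i k * V i k') = (if k = k' then 1 else 0)"
    and W_rows: "\<And>i i'. i < M2 \<Longrightarrow> i' < M2 \<Longrightarrow> (\<Sum>k<M2. W i k * W i' k) = (if i = i' then 1 else 0)"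
    and W_cols: "\<And>k k'. k < M2 \<Longrightarrow> k' < M2 \<Longrightarrow> (\<Sum>i<M2. W i k * W i k') = (if k = k' then 1 else 0)"
    and g: "\<And>i j. i < M1 \<Longrightarrow> j < M2 \<Longrightarrow> g i j = (\<Sum>k<min M1 M2. V i k * s k * W j k)"
    and d_le: "d \<le> min M1 M2"
    and s_top: "\<And>k. k < d \<Longrightarrow> s k = \<sigma>"
    and s_below: "\<And>k. d \<le> k \<Longrightarrow> s k < \<sigma>"
    and s_nonneg: "\<And>k. 0 \<le> s k"
    and s_outside: "\<And>k. min M1 M2 \<le> k \<Longrightarrow> s k = 0"
begin

text \<open>The weight at which the two halves of the AM-GM bound balance: \<open>c * M1\<close> and
  \<open>M2 / c\<close> are both \<open>sqrt (M1 * M2)\<close>.\<close>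

definition c :: real where "c = sqrt (real M2 / real M1)"

lemma c_pos: "0 < c" using M1 M2 by (simp add: c_def)

lemma c_square: "c\<^sup>2 = real M2 / real M1" by (simp add: c_def)

lemma c_M1: "c * real M1 = sqrt (real (M1 * M2))"
proof (rule power2_eq_imp_eq)
  show "(c * real M1)\<^sup>2 = (sqrt (real (M1 * M2)))\<^sup>2"
    using M1 by (simp add: power_mult_distrib c_square) (simp add: power2_eq_square)
qed (use c_pos in auto)

lemma c_M2: "real M2 / c = sqrt (real (M1 * M2))"
proof -
  have "real M2 / c = c\<^sup>2 * real M1 / c" using M1 by (simp add: c_square)
  also have "\<dots> = c * real M1" using c_pos by (simp add: power2_eq_square)
  finally show ?thesis by (simp add: c_M1)
qed

section \<open>The correlation sum in singular coordinates\<close>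

lemma bilinear_form:
  "(\<Sum>i<M1. \<Sum>j<M2. g i j * (x i * y j))
     = (\<Sum>k<min M1 M2. s k * ((\<Sum>i<M1. V i k * x i) * (\<Sum>j<M2. W j k * y j)))"
proof -
  have "(\<Sum>i<M1. \<Sum>j<M2. g i j * (x i * y j))
      = (\<Sum>i<M1. \<Sum>j<M2. \<Sum>k<min M1 M2. s k * ((V i k * x i) * (W j k * y j)))"
    by (intro sum.cong refl) (simp add: g sum_distrib_left sum_distrib_right mult_ac)
  also have "\<dots> = (\<Sum>i<M1. \<Sum>k<min M1 M2. \<Sum>j<M2. s k * ((V i k * x i) * (W j k * y j)))"
    by (intro sum.cong refl sum.swap)
  also have "\<dots> = (\<Sum>k<min M1 M2. \<Sum>i<M1. \<Sum>j<M2. s k * ((V i k * x i) * (W j k * y j)))"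
    by (rule sum.swap)
  also have "\<dots> = (\<Sum>k<min M1 M2. s k * ((\<Sum>i<M1. V i k * x i) * (\<Sum>j<M2. W j k * y j)))"
    unfolding sum_product by (simp only: sum_distrib_left)
  finally show ?thesis .
qed

lemma bilinear_form_vec:
  "(\<Sum>i<M1. \<Sum>j<M2. g i j * (\<Sum>\<tau>\<in>T. x i \<tau> * y j \<tau>))
     = (\<Sum>k<min M1 M2. s k * (\<Sum>\<tau>\<in>T. (\<Sum>i<M1. V i k * x i \<tau>) * (\<Sum>j<M2. W j k * y j \<tau>)))"
proof -
  have "(\<Sum>i<M1. \<Sum>j<M2. g i j * (\<Sum>\<tau>\<in>T. x i \<tau> * y j \<tau>))
      = (\<Sum>i<M1. \<Sum>\<tau>\<in>T. \<Sum>j<M2. g i j * (x i \<tau> * y j \<tau>))"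
    unfolding sum_distrib_left by (intro sum.cong refl sum.swap)
  also have "\<dots> = (\<Sum>\<tau>\<in>T. \<Sum>i<M1. \<Sum>j<M2. g i j * (x i \<tau> * y j \<tau>))"
    by (rule sum.swap)
  also have "\<dots> = (\<Sum>\<tau>\<in>T. \<Sum>k<min M1 M2. s k * ((\<Sum>i<M1. V i k * x i \<tau>) * (\<Sum>j<M2. W j k * y j \<tau>)))"
    by (simp only: bilinear_form)
  also have "\<dots> = (\<Sum>k<min M1 M2. s k * (\<Sum>\<tau>\<in>T. (\<Sum>i<M1. V i k * x i \<tau>) * (\<Sum>j<M2. W j k * y j \<tau>)))"
    unfolding sum_distrib_left[where r = "s _"] by (rule sum.swap)
  finally show ?thesis .
qed

lemma sum_up_to_d:
  fixes f :: "nat \<Rightarrow> real"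
  assumes "d \<le> n" "\<And>k. d \<le> k \<Longrightarrow> k < n \<Longrightarrow> f k = 0"
  shows "(\<Sum>k<n. f k) = (\<Sum>k<d. f k)"
  using assms by (intro sum.mono_neutral_right) auto

text \<open>The defect \<open>\<sigma> sqrt (M1 M2) - \<Sum> g (x \<bullet> y)\<close> is a sum of the five nonnegative quantities
  \<open>D1\<close>, ..., \<open>D5\<close>, so at equality each of them vanishes.\<close>

lemma equality_case:
  assumes T: "finite T"
    and x: "\<forall>i<M1. (\<Sum>\<tau>\<in>T. (x i \<tau>)\<^sup>2) \<le> 1"
    and y: "\<forall>j<M2. (\<Sum>\<tau>\<in>T. (y j \<tau>)\<^sup>2) \<le> 1"
    and eq: "(\<Sum>i<M1. \<Sum>j<M2. g i j * (\<Sum>\<tau>\<in>T. x i \<tau> * y j \<tau>)) = sqrt (real (M1 * M2)) * \<sigma>"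
  defines "p \<equiv> \<lambda>k \<tau>. \<Sum>i<M1. V i k * x i \<tau>"
  shows "\<And>i. i < M1 \<Longrightarrow> (\<Sum>\<tau>\<in>T. (x i \<tau>)\<^sup>2) = 1"
    and "\<And>j. j < M2 \<Longrightarrow> (\<Sum>\<tau>\<in>T. (y j \<tau>)\<^sup>2) = 1"
    and "\<And>i \<tau>. i < M1 \<Longrightarrow> \<tau> \<in> T \<Longrightarrow> x i \<tau> = (\<Sum>k<d. V i k * p k \<tau>)"
    and "\<And>j \<tau>. j < M2 \<Longrightarrow> \<tau> \<in> T \<Longrightarrow> y j \<tau> = c * (\<Sum>k<d. W j k * p k \<tau>)"
proof -
  define q where "q = (\<lambda>k \<tau>. \<Sum>j<M2. W j k * y j \<tau>)"
  define P where "P = (\<lambda>k. \<Sum>\<tau>\<in>T. (p k \<tau>)\<^sup>2)"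
  define Q where "Q = (\<lambda>k. \<Sum>\<tau>\<in>T. (q k \<tau>)\<^sup>2)"
  define R where "R = (\<lambda>k. \<Sum>\<tau>\<in>T. p k \<tau> * q k \<tau>)"
  define m where "m = min M1 M2"
  have sumP: "(\<Sum>k<M1. P k) = (\<Sum>i<M1. \<Sum>\<tau>\<in>T. (x i \<tau>)\<^sup>2)"
  proof -
    have "(\<Sum>k<M1. P k) = (\<Sum>\<tau>\<in>T. \<Sum>k<M1. (p k \<tau>)\<^sup>2)" unfolding P_def by (rule sum.swap)
    also have "\<dots> = (\<Sum>\<tau>\<in>T. \<Sum>i<M1. (x i \<tau>)\<^sup>2)"
      unfolding p_def using orthogonal_rows_parseval[OF V_rows] by simp
    also have "\<dots> = (\<Sum>i<M1. \<Sum>\<tau>\<in>T. (x i \<tau>)\<^sup>2)" by (rule sum.swap)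
    finally show ?thesis .
  qed
  have sumQ: "(\<Sum>k<M2. Q k) = (\<Sum>j<M2. \<Sum>\<tau>\<in>T. (y j \<tau>)\<^sup>2)"
  proof -
    have "(\<Sum>k<M2. Q k) = (\<Sum>\<tau>\<in>T. \<Sum>k<M2. (q k \<tau>)\<^sup>2)" unfolding Q_def by (rule sum.swap)
    also have "\<dots> = (\<Sum>\<tau>\<in>T. \<Sum>i<M2. (y i \<tau>)\<^sup>2)"
      unfolding q_def using orthogonal_rows_parseval[OF W_rows] by simp
    also have "\<dots> = (\<Sum>i<M2. \<Sum>\<tau>\<in>T. (y i \<tau>)\<^sup>2)" by (rule sum.swap)
    finally show ?thesis .
  qed
  have PQ_nonneg: "0 \<le> P k" "0 \<le> Q k" for k by (simp_all add: P_def Q_def sum_nonneg)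
  have s_le: "s k \<le> \<sigma>" for k using s_top[of k] s_below[of k] by (cases "k < d") auto
  have x0: "0 \<le> 1 - (\<Sum>\<tau>\<in>T. (x i \<tau>)\<^sup>2)" if "i \<in> {..<M1}" for i using x that by simp
  have y0: "0 \<le> 1 - (\<Sum>\<tau>\<in>T. (y i \<tau>)\<^sup>2)" if "i \<in> {..<M2}" for i using y that by simp
  \<comment> \<open>\<open>D1\<close> and \<open>D2\<close> measure missing length of the vectors,
    \<open>D3\<close> and \<open>D4\<close> the mass outside the top singular space, and
    \<open>D5\<close> the AM-GM gap. \<open>D3\<close> and \<open>D4\<close> run over all of
    \<open>M1\<close> and \<open>M2\<close>: where \<open>s\<close> is 0, mass is penalized with
    full weight \<sigma>.\<close>
  define D1 where "D1 = (\<Sum>i<M1. 1 - (\<Sum>\<tau>\<in>T. (x i \<tau>)\<^sup>2))"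
  define D2 where "D2 = (\<Sum>j<M2. 1 - (\<Sum>\<tau>\<in>T. (y j \<tau>)\<^sup>2))"
  define D3 where "D3 = (\<Sum>k<M1. (\<sigma> - s k) * P k)"
  define D4 where "D4 = (\<Sum>k<M2. (\<sigma> - s k) * Q k)"
  define D5 where "D5 = (\<Sum>k<m. s k * (\<Sum>\<tau>\<in>T. (c * p k \<tau> - q k \<tau>)\<^sup>2))"
  have nonneg: "0 \<le> D1" "0 \<le> D2" "0 \<le> D3" "0 \<le> D4" "0 \<le> D5"
    unfolding D1_def D2_def D3_def D4_def D5_def using x0 y0 PQ_nonneg s_le s_nonneg
    by (auto intro!: sum_nonneg mult_nonneg_nonneg)
  have D1: "(\<Sum>k<M1. P k) = real M1 - D1" unfolding sumP D1_def by (simp add: sum_subtractf)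
  have D2: "(\<Sum>k<M2. Q k) = real M2 - D2" unfolding sumQ D2_def by (simp add: sum_subtractf)
  have sm: "(\<Sum>k<n. s k * f k) = (\<Sum>k<m. s k * f k)" if "m \<le> n" for n and f :: "nat \<Rightarrow> real"
    using that s_outside by (intro sum.mono_neutral_right) (auto simp: m_def not_less)
  have D3: "D3 = \<sigma> * (\<Sum>k<M1. P k) - (\<Sum>k<m. s k * P k)"
    using sm[of M1 P] unfolding D3_def
    by (simp add: left_diff_distrib sum_subtractf sum_distrib_left m_def)
  have D4: "D4 = \<sigma> * (\<Sum>k<M2. Q k) - (\<Sum>k<m. s k * Q k)"
    using sm[of M2 Q] unfolding D4_def
    by (simp add: left_diff_distrib sum_subtractf sum_distrib_left m_def)
  have D5: "D5 = c\<^sup>2 * (\<Sum>k<m. s k * P k) - 2 * c * (\<Sum>k<m. s k * R k) + (\<Sum>k<m. s k * Q k)"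
  proof -
    have "(\<Sum>\<tau>\<in>T. (c * p k \<tau> - q k \<tau>)\<^sup>2) = c\<^sup>2 * P k - 2 * c * R k + Q k" for k
      unfolding P_def Q_def R_def sum_distrib_left sum_subtractf[symmetric] sum.distrib[symmetric]
      by (intro sum.cong refl) (simp add: power2_eq_square algebra_simps)
    note expand = this
    have "D5 = (\<Sum>k<m. c\<^sup>2 * (s k * P k) - 2 * c * (s k * R k) + s k * Q k)"
      unfolding D5_def expand by (intro sum.cong refl) (simp add: algebra_simps)
    then show ?thesis by (simp add: sum.distrib sum_subtractf sum_distrib_left)
  qed
  have R: "(\<Sum>k<m. s k * R k) = sqrt (real (M1 * M2)) * \<sigma>"
    using eq unfolding bilinear_form_vec R_def p_def q_def m_def .
  have cc: "c\<^sup>2 * real M1 = c * sqrt (real (M1 * M2))" "real M2 = c * sqrt (real (M1 * M2))"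
    using c_M1 c_M2 c_pos by (simp_all add: power2_eq_square mult.assoc) (simp add: field_simps)
  \<comment> \<open>In general this weighted sum is \<open>2 * c\<close> times the defect, and the
    hypothesis \<open>eq\<close>, in the form \<open>R\<close>, makes it zero.\<close>
  have "D5 + D4 + c\<^sup>2 * D3 + \<sigma> * D2 + \<sigma> * (c\<^sup>2 * D1)
      = \<sigma> * (c\<^sup>2 * real M1) + \<sigma> * real M2 - 2 * c * (sqrt (real (M1 * M2)) * \<sigma>)"
    unfolding D5 R D3 D4 D1 D2 by (simp add: algebra_simps)
  also have "\<dots> = 0" unfolding cc(1) by (subst cc(2)) (simp add: algebra_simps)
  finally have total: "D5 + D4 + c\<^sup>2 * D3 + \<sigma> * D2 + \<sigma> * (c\<^sup>2 * D1) = 0" .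
  have parts: "0 \<le> c\<^sup>2 * D3" "0 \<le> \<sigma> * D2" "0 \<le> \<sigma> * (c\<^sup>2 * D1)"
    using nonneg \<sigma> by simp_all
  have zero: "D1 = 0" "D2 = 0" "D3 = 0" "D4 = 0" "D5 = 0"
  proof -
    have "D5 = 0" "D4 = 0" "c\<^sup>2 * D3 = 0" "\<sigma> * D2 = 0" "\<sigma> * (c\<^sup>2 * D1) = 0"
      using total parts nonneg by linarith+
    then show "D1 = 0" "D2 = 0" "D3 = 0" "D4 = 0" "D5 = 0" using \<sigma> c_pos by simp_all
  qed
  show "(\<Sum>\<tau>\<in>T. (x i \<tau>)\<^sup>2) = 1" if "i < M1" for i
    using zero(1) x0 that unfolding D1_def by (subst (asm) sum_nonneg_eq_0_iff) auto
  show "(\<Sum>\<tau>\<in>T. (y i \<tau>)\<^sup>2) = 1" if "i < M2" for i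
    using zero(2) y0 that unfolding D2_def by (subst (asm) sum_nonneg_eq_0_iff) auto
  have p0: "p k \<tau> = 0" if k: "d \<le> k" "k < M1" and \<tau>: "\<tau> \<in> T" for k \<tau>
  proof -
    have "(\<sigma> - s k) * P k = 0"
      using zero(3) k s_le PQ_nonneg unfolding D3_def
      by (subst (asm) sum_nonneg_eq_0_iff) auto
    then have "P k = 0" using s_below[OF k(1)] by simp
    then show ?thesis using \<tau> T unfolding P_def by (simp add: sum_nonneg_eq_0_iff)
  qed
  have q0: "q k \<tau> = 0" if k: "d \<le> k" "k < M2" and \<tau>: "\<tau> \<in> T" for k \<tau>
  proof -
    have "(\<sigma> - s k) * Q k = 0"
      using zero(4) k s_le PQ_nonneg unfolding D4_def
      by (subst (asm) sum_nonneg_eq_0_iff) auto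
    then have "Q k = 0" using s_below[OF k(1)] by simp
    then show ?thesis using \<tau> T unfolding Q_def by (simp add: sum_nonneg_eq_0_iff)
  qed
  have qp: "q k \<tau> = c * p k \<tau>" if k: "k < d" and \<tau>: "\<tau> \<in> T" for k \<tau>
  proof -
    have "s k * (\<Sum>\<tau>\<in>T. (c * p k \<tau> - q k \<tau>)\<^sup>2) = 0"
      using zero(5) k d_le s_nonneg unfolding D5_def m_def
      by (subst (asm) sum_nonneg_eq_0_iff) (auto intro!: mult_nonneg_nonneg sum_nonneg)
    then have "(\<Sum>\<tau>\<in>T. (c * p k \<tau> - q k \<tau>)\<^sup>2) = 0" using s_top[OF k] \<sigma> by simp
    then show ?thesis using \<tau> T by (simp add: sum_nonneg_eq_0_iff)
  qed
  show "x i \<tau> = (\<Sum>k<d. V i k * p k \<tau>)" if "i < M1" "\<tau> \<in> T" for i \<tau>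
  proof -
    have "x i \<tau> = (\<Sum>k<M1. V i k * p k \<tau>)"
      unfolding p_def using orthogonal_rows_expansion[OF V_rows that(1)] by simp
    also have "\<dots> = (\<Sum>k<d. V i k * p k \<tau>)"
      using d_le p0 that(2) by (intro sum_up_to_d) auto
    finally show ?thesis .
  qed
  show "y j \<tau> = c * (\<Sum>k<d. W j k * p k \<tau>)" if "j < M2" "\<tau> \<in> T" for j \<tau>
  proof -
    have "y j \<tau> = (\<Sum>k<M2. W j k * q k \<tau>)"
      unfolding q_def using orthogonal_rows_expansion[OF W_rows that(1)] by simp
    also have "\<dots> = (\<Sum>k<d. W j k * q k \<tau>)"
      using d_le q0 that(2) by (intro sum_up_to_d) auto
    also have "\<dots> = (\<Sum>k<d. c * (W j k * p k \<tau>))"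
      using qp that(2) by (intro sum.cong refl) auto
    finally show ?thesis by (simp add: sum_distrib_left)
  qed
qed

text \<open>Condition (b) with columns of \<alpha> indexed by an arbitrary set: a quantum strategy
  first yields a solution over a large index set, while matrices correspond to
  \<open>{..<d'}\<close>.\<close>

definition feasible :: "'b set \<Rightarrow> (nat \<Rightarrow> 'b \<Rightarrow> real) \<Rightarrow> bool" where
  "feasible T \<alpha> \<longleftrightarrow> (\<forall>i<M1. (\<Sum>t\<in>T. (\<Sum>k<d. V i k * \<alpha> k t)\<^sup>2) = 1) \<and>
     (\<forall>j<M2. (\<Sum>t\<in>T. (\<Sum>k<d. W j k * \<alpha> k t)\<^sup>2) = real M1 / real M2)"

text \<open>Assuming only norms at most 1 lets this serve both the unit vectors of (a) and the
  vectors extracted from a quantum strategy; equality forces the norms to be 1. The factor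
  \<open>M1 / M2\<close> arises as \<open>1 / c\<close> squared.\<close>

lemma optimal_imp_feasible:
  assumes T: "finite T"
    and x: "\<forall>i<M1. (\<Sum>\<tau>\<in>T. (x i \<tau>)\<^sup>2) \<le> 1"
    and y: "\<forall>j<M2. (\<Sum>\<tau>\<in>T. (y j \<tau>)\<^sup>2) \<le> 1"
    and eq: "(\<Sum>i<M1. \<Sum>j<M2. g i j * (\<Sum>\<tau>\<in>T. x i \<tau> * y j \<tau>)) = sqrt (real (M1 * M2)) * \<sigma>"
  shows "feasible T (\<lambda>k \<tau>. \<Sum>i<M1. V i k * x i \<tau>)"
  unfolding feasible_def
proof (intro conjI allI impI)
  note E = equality_case[OF T x y eq]
  fix i assume i: "i < M1"
  show "(\<Sum>t\<in>T. (\<Sum>k<d. V i k * (\<Sum>i<M1. V i k * x i t))\<^sup>2) = 1"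
    using E(1)[OF i] E(3)[OF i] by simp
next
  note E = equality_case[OF T x y eq]
  fix j assume j: "j < M2"
  let ?u = "\<lambda>t. \<Sum>k<d. W j k * (\<Sum>i<M1. V i k * x i t)"
  have "1 = (\<Sum>t\<in>T. (c * ?u t)\<^sup>2)" using E(2)[OF j] E(4)[OF j] by simp
  also have "\<dots> = real M2 / real M1 * (\<Sum>t\<in>T. (?u t)\<^sup>2)"
    unfolding power_mult_distrib c_square by (rule sum_distrib_left[symmetric])
  finally show "(\<Sum>t\<in>T. (?u t)\<^sup>2) = real M1 / real M2" using M1 M2 by (simp add: field_simps)
qed

text \<open>By orthonormality of the columns, the singular coordinates of the two families are
  \<alpha> and \<open>c\<close> times \<alpha> on the top space and 0 elsewhere. The sum is thus
  \<sigma> times \<open>c\<close> times the squared Frobenius norm of \<alpha>, which is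
  \<open>M1\<close> by Parseval.\<close>

lemma feasible_imp_optimal:
  assumes "feasible T \<alpha>"
  shows "(\<Sum>i<M1. \<Sum>j<M2. g i j * (\<Sum>t\<in>T. (\<Sum>k<d. V i k * \<alpha> k t) * (c * (\<Sum>k<d. W j k * \<alpha> k t))))
     = sqrt (real (M1 * M2)) * \<sigma>"
proof -
  \<comment> \<open>Feasibility says nothing about rows of \<alpha> from \<open>d\<close> on, so
    they are replaced by zero before sums are extended beyond \<open>d\<close>.\<close>
  define \<beta> where "\<beta> = (\<lambda>k t. if k < d then \<alpha> k t else 0)"
  let ?x = "\<lambda>i t. \<Sum>k<d. V i k * \<alpha> k t"
  let ?y = "\<lambda>j t. c * (\<Sum>k<d. W j k * \<alpha> k t)"
  have ext: "(\<Sum>k<d. U k * \<alpha> k t) = (\<Sum>k<n. U k * \<beta> k t)" if "d \<le> n" for U n t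
    unfolding \<beta>_def using that by (subst sum_up_to_d[of n]) auto
  have p: "(\<Sum>i<M1. V i k * ?x i t) = \<beta> k t" if "k < M1" for k t
    using orthogonal_rows_expansion[of M1 "\<lambda>k i. V i k", OF V_cols that, of "\<lambda>k. \<beta> k t"] d_le
    by (simp add: ext[of M1])
  have q: "(\<Sum>j<M2. W j k * ?y j t) = c * \<beta> k t" if "k < M2" for k t
  proof -
    have "(\<Sum>j<M2. W j k * ?y j t) = (\<Sum>j<M2. c * (W j k * (\<Sum>k<d. W j k * \<alpha> k t)))"
      by (intro sum.cong refl) (rule mult.left_commute)
    also have "\<dots> = c * (\<Sum>j<M2. W j k * (\<Sum>k<d. W j k * \<alpha> k t))"
      by (rule sum_distrib_left[symmetric])
    also have "\<dots> = c * \<beta> k t"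
      using orthogonal_rows_expansion[of M2 "\<lambda>k i. W i k", OF W_cols that, of "\<lambda>k. \<beta> k t"] d_le
      by (simp add: ext[of M2])
    finally show ?thesis .
  qed
  have "(\<Sum>k<M1. \<Sum>t\<in>T. (\<beta> k t)\<^sup>2) = (\<Sum>t\<in>T. \<Sum>k<M1. (\<beta> k t)\<^sup>2)" by (rule sum.swap)
  also have "\<dots> = (\<Sum>t\<in>T. \<Sum>k<M1. (\<Sum>i<M1. V i k * ?x i t)\<^sup>2)" by (simp add: p)
  also have "\<dots> = (\<Sum>t\<in>T. \<Sum>i<M1. (?x i t)\<^sup>2)"
    by (simp only: orthogonal_rows_parseval[OF V_rows])
  also have "\<dots> = (\<Sum>i<M1. \<Sum>t\<in>T. (?x i t)\<^sup>2)" by (rule sum.swap)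
  also have "\<dots> = real M1" using assms by (simp add: feasible_def)
  finally have mass: "(\<Sum>k<M1. \<Sum>t\<in>T. (\<beta> k t)\<^sup>2) = real M1" .
  have "(\<Sum>i<M1. \<Sum>j<M2. g i j * (\<Sum>t\<in>T. ?x i t * ?y j t))
      = (\<Sum>k<min M1 M2. s k * (\<Sum>t\<in>T. \<beta> k t * (c * \<beta> k t)))"
    unfolding bilinear_form_vec by (intro sum.cong refl) (simp add: p q)
  also have "\<dots> = (\<Sum>k<min M1 M2. \<sigma> * (c * (\<Sum>t\<in>T. (\<beta> k t)\<^sup>2)))"
    proof (intro sum.cong refl)
    fix k
    show "s k * (\<Sum>t\<in>T. \<beta> k t * (c * \<beta> k t)) = \<sigma> * (c * (\<Sum>t\<in>T. (\<beta> k t)\<^sup>2))"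
      by (cases "k < d") (simp_all add: s_top \<beta>_def sum_distrib_left power2_eq_square mult_ac)
  qed
  also have "\<dots> = (\<Sum>k<M1. \<sigma> * (c * (\<Sum>t\<in>T. (\<beta> k t)\<^sup>2)))"
    using d_le by (intro sum.mono_neutral_left) (auto simp: \<beta>_def not_less[symmetric])
  also have "\<dots> = \<sigma> * (c * real M1)" unfolding mass[symmetric] by (simp only: sum_distrib_left)
  finally show ?thesis by (simp add: c_M1)
qed

text \<open>Only the Gram matrix of the rows of \<open>\<alpha>\<close> matters, and it factors through dimension \<open>d\<close>.\<close>

lemma feasible_reduce:
  assumes "feasible T \<alpha>"
  shows "\<exists>\<beta>. feasible ({..<d} :: nat set) \<beta>"
proof -
  obtain \<beta> where \<beta>: "\<forall>k\<in>{..<d}. \<forall>l\<in>{..<d}. (\<Sum>\<tau>\<in>T. \<alpha> k \<tau> * \<alpha> l \<tau>) = (\<Sum>t\<in>{..<d}. \<beta> k t * \<beta> l t)"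
    using psd_on_factorization[OF finite_lessThan psd_on_gram] by blast
  have gram: "(\<Sum>t\<in>A. (\<Sum>k<d. u k * a k t)\<^sup>2) = (\<Sum>k<d. \<Sum>l<d. u k * u l * (\<Sum>t\<in>A. a k t * a l t))"
    for A :: "'c set" and u :: "nat \<Rightarrow> real" and a
  proof -
    have "(\<Sum>t\<in>A. (\<Sum>k<d. u k * a k t)\<^sup>2) = (\<Sum>t\<in>A. \<Sum>k<d. \<Sum>l<d. u k * u l * (a k t * a l t))"
      unfolding power2_eq_square sum_product by (intro sum.cong refl) (simp add: mult_ac)
    also have "\<dots> = (\<Sum>k<d. \<Sum>t\<in>A. \<Sum>l<d. u k * u l * (a k t * a l t))" by (rule sum.swap)
    also have "\<dots> = (\<Sum>k<d. \<Sum>l<d. \<Sum>t\<in>A. u k * u l * (a k t * a l t))"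
      by (intro sum.cong refl sum.swap)
    finally show ?thesis by (simp add: sum_distrib_left)
  qed
  have "(\<Sum>t<d. (\<Sum>k<d. u k * \<beta> k t)\<^sup>2) = (\<Sum>\<tau>\<in>T. (\<Sum>k<d. u k * \<alpha> k \<tau>)\<^sup>2)" for u
    unfolding gram using \<beta> by (intro sum.cong refl) auto
  then have "feasible ({..<d} :: nat set) \<beta>" using assms unfolding feasible_def by simp
  then show ?thesis by (intro exI[of _ \<beta>])
qed

end

section \<open>From quantum strategies to vectors\<close>

lemma exponential_beats_polynomial_growth:
  fixes r c1 c2 C m :: real
  assumes r: "1 < r" and m: "0 < m"
  shows "\<exists>k. C * (c1 + c2 * real k ^ p)\<^sup>2 < m * r ^ k"
proof -
  have pow: "(\<lambda>k. real k ^ p / r ^ k) \<longlonglongrightarrow> 0" for p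
    using r by real_asymp
  have "(\<lambda>k. C * (c1\<^sup>2 * (real k ^ 0 / r ^ k) + 2 * c1 * c2 * (real k ^ p / r ^ k)
      + c2\<^sup>2 * (real k ^ (2 * p) / r ^ k))) \<longlonglongrightarrow>
      C * (c1\<^sup>2 * 0 + 2 * c1 * c2 * 0 + c2\<^sup>2 * 0)"
    by (intro tendsto_intros pow)
  moreover have "C * (c1\<^sup>2 * (real k ^ 0 / r ^ k) + 2 * c1 * c2 * (real k ^ p / r ^ k)
      + c2\<^sup>2 * (real k ^ (2 * p) / r ^ k)) = C * (c1 + c2 * real k ^ p)\<^sup>2 / r ^ k" for k
  proof -
    have "C * (c1\<^sup>2 * (1 / R) + 2 * c1 * c2 * (x / R) + c2\<^sup>2 * (x\<^sup>2 / R)) = C * (c1 + c2 * x)\<^sup>2 / R"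
      for x R :: real
      by (cases "R = 0") (simp_all add: power2_eq_square field_simps)
    from this[of "r ^ k" "real k ^ p"] show ?thesis
      by (simp add: power_mult[symmetric] mult.commute[of p])
  qed
  ultimately have "(\<lambda>k. C * (c1 + c2 * real k ^ p)\<^sup>2 / r ^ k) \<longlonglongrightarrow> 0" by simp
  then have "eventually (\<lambda>k. C * (c1 + c2 * real k ^ p)\<^sup>2 / r ^ k < m) sequentially"
    using m by (rule order_tendstoD)
  then obtain k where "C * (c1 + c2 * real k ^ p)\<^sup>2 / r ^ k < m"
    by (auto simp: eventually_sequentially)
  then show ?thesis using r by (intro exI[of _ k]) (simp add: field_simps)
qed

text \<open>Vectors are functions here, so that an operator can act on one tensor factor by fixing
  the coordinate of the other.\<close>

definition apply_mat :: "nat \<Rightarrow> complex mat \<Rightarrow> (nat \<Rightarrow> complex) \<Rightarrow> nat \<Rightarrow> complex" where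
  "apply_mat n A x = (\<lambda>a. \<Sum>b<n. A $$ (a, b) * x b)"

lemma apply_mat_pow:
  assumes A: "A \<in> carrier_mat n n" and a: "a < n"
  shows "(apply_mat n A ^^ k) x a = (\<Sum>b<n. (A ^\<^sub>m k) $$ (a, b) * x b)"
proof (induction k arbitrary: x)
  case 0
  have "(\<Sum>b<n. 1\<^sub>m n $$ (a, b) * x b) = (\<Sum>b<n. if b = a then x b else 0)"
    using a by (intro sum.cong refl) auto
  then show ?case using a A by simp
next
  case (Suc k)
  have Ak: "A ^\<^sub>m k \<in> carrier_mat n n" using A by simp
  have "(apply_mat n A ^^ Suc k) x a = (\<Sum>b<n. (A ^\<^sub>m k) $$ (a, b) * (\<Sum>c<n. A $$ (b, c) * x c))"
    unfolding funpow_Suc_right comp_def Suc by (simp add: apply_mat_def)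
  also have "\<dots> = (\<Sum>b<n. \<Sum>c<n. (A ^\<^sub>m k) $$ (a, b) * A $$ (b, c) * x c)"
    by (simp add: sum_distrib_left mult.assoc)
  also have "\<dots> = (\<Sum>c<n. \<Sum>b<n. (A ^\<^sub>m k) $$ (a, b) * A $$ (b, c) * x c)"
    by (rule sum.swap)
  also have "\<dots> = (\<Sum>c<n. (A ^\<^sub>m Suc k) $$ (a, c) * x c)"
    using A Ak a by (intro sum.cong refl)
      (auto simp: scalar_prod_def sum_distrib_right atLeast0LessThan)
  finally show ?case .
qed

lemma hermitian_apply_mat:
  assumes "hermitian_mat n A"
  shows "(\<Sum>a<n. cnj (apply_mat n A u a) * v a) = (\<Sum>a<n. cnj (u a) * apply_mat n A v a)"
proof -
  have cnj_A: "cnj (A $$ (a, b)) = A $$ (b, a)" if "a < n" "b < n" for a b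
    using assms that unfolding hermitian_mat_def by metis
  have "(\<Sum>a<n. cnj (apply_mat n A u a) * v a) = (\<Sum>a<n. \<Sum>b<n. cnj (u b) * (cnj (A $$ (a, b)) * v a))"
    unfolding apply_mat_def by (intro sum.cong refl) (simp add: sum_distrib_left sum_distrib_right mult_ac)
  also have "\<dots> = (\<Sum>a<n. \<Sum>b<n. cnj (u b) * (A $$ (b, a) * v a))"
    using cnj_A by (intro sum.cong refl) auto
  also have "\<dots> = (\<Sum>b<n. \<Sum>a<n. cnj (u b) * (A $$ (b, a) * v a))" by (rule sum.swap)
  finally show ?thesis unfolding apply_mat_def by (simp add: sum_distrib_left)
qed

lemma Re_cnj_mult_le:
  fixes u v :: complex
  assumes "0 < r"
  shows "2 * Re (cnj u * v) \<le> r * (cmod u)\<^sup>2 + (cmod v)\<^sup>2 / r"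
proof -
  have "2 * Re (cnj u * v) \<le> 2 * (cmod u * cmod v)"
    using complex_Re_le_cmod[of "cnj u * v"] by (simp add: norm_mult)
  also have "\<dots> \<le> r * (cmod u)\<^sup>2 + (cmod v)\<^sup>2 / r"
  proof -
    have "0 \<le> (r * cmod u - cmod v)\<^sup>2 / r" using assms by simp
    also have "\<dots> = r * (cmod u)\<^sup>2 + (cmod v)\<^sup>2 / r - 2 * (cmod u * cmod v)"
      using assms by (simp add: power2_eq_square field_simps)
    finally show ?thesis by simp
  qed
  finally show ?thesis .
qed

text \<open>If \<open>\<parallel>A x\<parallel>\<^sup>2 = r \<parallel>x\<parallel>\<^sup>2\<close> with \<open>r > 1\<close>, then \<open>\<parallel>A\<^sup>k x\<parallel>\<^sup>2 \<ge> r\<^sup>k \<parallel>x\<parallel>\<^sup>2\<close> because \<open>A\<close> is Hermitian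
  (log-convexity), whereas powers of a matrix of spectral radius at most 1 grow polynomially.
  This replaces the spectral theorem.\<close>

lemma observable_contraction:
  assumes obs: "observable n A"
  shows "(\<Sum>a<n. (cmod (apply_mat n A x a))\<^sup>2) \<le> (\<Sum>a<n. (cmod (x a))\<^sup>2)"
proof (rule ccontr)
  assume less: "\<not> ?thesis"
  have herm: "hermitian_mat n A" and A: "A \<in> carrier_mat n n"
    using obs unfolding observable_def hermitian_mat_def by blast+
  have n: "0 < n" using less by (cases n) auto
  define m where "m = (\<lambda>k. \<Sum>a<n. (cmod ((apply_mat n A ^^ k) x a))\<^sup>2)"
  have m01: "m 0 < m 1" using less by (simp add: m_def)
  have m0: "0 < m 0"
  proof (rule ccontr)
    assume "\<not> 0 < m 0"
    then have "m 0 = 0" unfolding m_def by (simp add: sum_nonneg order.antisym not_less)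
    then have "x a = 0" if "a < n" for a
      using that unfolding m_def by (simp add: sum_nonneg_eq_0_iff)
    then have "m 1 = 0" by (simp add: m_def apply_mat_def)
    with m01 \<open>m 0 = 0\<close> show False by simp
  qed
  define r where "r = m 1 / m 0"
  have r: "1 < r" using m0 m01 by (simp add: r_def)
  \<comment> \<open>Hermiticity makes \<open>m (Suc k)\<close> the inner product of iterates
    \<open>k\<close> and \<open>k + 2\<close>; AM-GM with weight \<open>r\<close> bounds it by their
    norms.\<close>
  have step: "2 * m (Suc k) \<le> r * m k + m (Suc (Suc k)) / r" for k
  proof -
    let ?z = "(apply_mat n A ^^ k) x"
    have sq: "complex_of_real ((cmod w)\<^sup>2) = cnj w * w" for w
      by (simp add: complex_norm_square mult.commute del: of_real_power)
    have "complex_of_real (m (Suc k)) = (\<Sum>a<n. cnj (apply_mat n A ?z a) * apply_mat n A ?z a)"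
      unfolding m_def of_real_sum sq by simp
    also have "\<dots> = (\<Sum>a<n. cnj (?z a) * apply_mat n A (apply_mat n A ?z) a)"
      by (rule hermitian_apply_mat[OF herm])
    finally have "m (Suc k) = Re (\<Sum>a<n. cnj (?z a) * apply_mat n A (apply_mat n A ?z) a)"
      by (metis Re_complex_of_real)
    then have "2 * m (Suc k) = (\<Sum>a<n. 2 * Re (cnj (?z a) * apply_mat n A (apply_mat n A ?z) a))"
      by (simp only: Re_sum sum_distrib_left)
    also have "\<dots> \<le> (\<Sum>a<n. r * (cmod (?z a))\<^sup>2 + (cmod (apply_mat n A (apply_mat n A ?z) a))\<^sup>2 / r)"
      using r by (intro sum_mono Re_cnj_mult_le) auto
    also have "\<dots> = r * m k + m (Suc (Suc k)) / r"
      unfolding m_def by (simp add: sum.distrib sum_distrib_left sum_divide_distrib)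
    finally show ?thesis .
  qed
  have growth: "r * m k \<le> m (Suc k)" for k
  proof (induction k)
    case 0
    then show ?case using m0 by (simp add: r_def)
  next
    case (Suc k)
    \<comment> \<open>The induction hypothesis replaces \<open>r * m k\<close> by
      \<open>m (Suc k)\<close>, cancelling one of the two copies on the left of
      \<open>step\<close>.\<close>
    then have "m (Suc k) \<le> m (Suc (Suc k)) / r" using step[of k] by linarith
    then show ?case using r by (simp add: field_simps)
  qed
  have exp_growth: "m 0 * r ^ k \<le> m k" for k
  proof (induction k)
    case (Suc k)
    have "m 0 * r ^ Suc k \<le> r * m k" using Suc r by simp
    also have "\<dots> \<le> m (Suc k)" by (rule growth)
    finally show ?case .
  qed simp
  have "spectral_radius A \<le> 1"
    using spectral_radius_mem_max(1)[OF A n] obs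
    by (auto simp: observable_def spectrum_def)
  \<comment> \<open>The entries of the powers are bounded by a polynomial in \<open>k\<close>, which
    is incompatible with the growth \<open>r ^ k\<close>.\<close>
  from spectral_radius_jnf_norm_bound_le_1_upper_triangular[OF A this]
  obtain c1 c2 where nb: "\<And>k. norm_bound (A ^\<^sub>m k) (c1 + c2 * real k ^ (n - 1))" by blast
  define X where "X = (\<Sum>b<n. cmod (x b))"
  have upper: "m k \<le> real n * X\<^sup>2 * (c1 + c2 * real k ^ (n - 1))\<^sup>2" for k
  proof -
    have "(cmod ((apply_mat n A ^^ k) x a))\<^sup>2 \<le> ((c1 + c2 * real k ^ (n - 1)) * X)\<^sup>2" if "a < n" for a
    proof (rule power_mono)
      have "cmod ((apply_mat n A ^^ k) x a) \<le> (\<Sum>b<n. cmod ((A ^\<^sub>m k) $$ (a, b)) * cmod (x b))"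
        unfolding apply_mat_pow[OF A that] by (rule order.trans[OF norm_sum]) (simp add: norm_mult)
      also have "\<dots> \<le> (\<Sum>b<n. (c1 + c2 * real k ^ (n - 1)) * cmod (x b))"
        using nb[of k] A that unfolding norm_bound_def
        by (intro sum_mono mult_right_mono) auto
      finally show "cmod ((apply_mat n A ^^ k) x a) \<le> (c1 + c2 * real k ^ (n - 1)) * X"
        by (simp add: X_def sum_distrib_left)
    qed simp
    then have "m k \<le> (\<Sum>a<n. ((c1 + c2 * real k ^ (n - 1)) * X)\<^sup>2)"
      unfolding m_def by (intro sum_mono) auto
    then show ?thesis by (simp add: power_mult_distrib mult_ac)
  qed
  obtain k where "real n * X\<^sup>2 * (c1 + c2 * real k ^ (n - 1))\<^sup>2 < m 0 * r ^ k"
    using exponential_beats_polynomial_growth[OF r m0] by blast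
  with upper[of k] exp_growth[of k] show False by linarith
qed

text \<open>The complex matrix is replaced by its real symmetric form of twice the size, with
  \<open>False\<close> marking real and \<open>True\<close> imaginary coordinates; the real
  factorization applies to it and is read back as complex vectors.\<close>

lemma density_factorization:
  assumes "density_op N \<rho>"
  obtains \<phi> :: "nat \<times> bool \<Rightarrow> nat \<Rightarrow> complex"
  where "\<And>i j. i < N \<Longrightarrow> j < N \<Longrightarrow> \<rho> $$ (i, j) = (\<Sum>t\<in>{..<N} \<times> UNIV. \<phi> t i * cnj (\<phi> t j))"
proof -
  have \<rho>: "\<rho> \<in> carrier_mat N N"
    and herm: "\<And>i j. i < N \<Longrightarrow> j < N \<Longrightarrow> \<rho> $$ (i, j) = cnj (\<rho> $$ (j, i))"
    and pos: "\<And>v. v \<in> carrier_vec N \<Longrightarrow> 0 \<le> Re (\<Sum>i<N. cnj (v $ i) * (\<rho> *\<^sub>v v) $ i)"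
    using assms unfolding density_op_def hermitian_mat_def by blast+
  have Re_sym: "Re (\<rho> $$ (i, j)) = Re (\<rho> $$ (j, i))"
    and Im_sym: "Im (\<rho> $$ (i, j)) = - Im (\<rho> $$ (j, i))" if "i < N" "j < N" for i j
    using arg_cong[OF herm[OF that], of Re] arg_cong[OF herm[OF that], of Im] by auto
  define I where "I = {..<N} \<times> (UNIV :: bool set)"
  \<comment> \<open>The block matrix with Re \<rho> on the diagonal, Im \<rho> in block
    \<open>(True, False)\<close> and its negative in block \<open>(False, True)\<close>; its
    quadratic form at the real and imaginary parts of \<open>z\<close> is that of \<rho> at
    \<open>z\<close>.\<close>
  define G where "G = (\<lambda>(i, a) (j, b). if a = b then Re (\<rho> $$ (i, j))
    else if a then Im (\<rho> $$ (i, j)) else - Im (\<rho> $$ (i, j)))"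
  have sumI: "(\<Sum>t\<in>I. f t) = (\<Sum>i<N. f (i, False) + f (i, True))" for f :: "nat \<times> bool \<Rightarrow> real"
  proof -
    have "(\<Sum>t\<in>I. f t) = (\<Sum>i<N. \<Sum>b\<in>UNIV. f (i, b))"
      unfolding I_def sum.cartesian_product by simp
    then show ?thesis by (simp add: UNIV_bool)
  qed
  have "psd_on I G"
    unfolding psd_on_def
  proof (intro conjI allI ballI)
    fix s t assume "s \<in> I" "t \<in> I"
    then obtain i a j b where st: "s = (i, a)" "t = (j, b)" and "i < N" "j < N"
      by (cases s; cases t) (auto simp: I_def)
    then show "G s t = G t s"
      using Re_sym[of i j] Im_sym[of i j] by (simp add: G_def)
  next
    fix x :: "nat \<times> bool \<Rightarrow> real"
    define z where "z = (\<lambda>i. Complex (x (i, False)) (x (i, True)))"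
    have "0 \<le> Re (\<Sum>i<N. cnj (vec N z $ i) * (\<rho> *\<^sub>v vec N z) $ i)" by (rule pos) simp
    also have "(\<Sum>i<N. cnj (vec N z $ i) * (\<rho> *\<^sub>v vec N z) $ i)
        = (\<Sum>i<N. \<Sum>j<N. cnj (z i) * (\<rho> $$ (i, j) * z j))"
      using \<rho> by (intro sum.cong refl)
        (auto simp: scalar_prod_def atLeast0LessThan sum_distrib_left intro!: sum.cong)
    also have "Re \<dots> = (\<Sum>i<N. \<Sum>j<N. Re (cnj (z i) * (\<rho> $$ (i, j) * z j)))"
      by (simp only: Re_sum)
    also have "\<dots> = (\<Sum>i<N. \<Sum>j<N. (x (i, False) * x (j, False) * G (i, False) (j, False)
          + x (i, False) * x (j, True) * G (i, False) (j, True))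
        + (x (i, True) * x (j, False) * G (i, True) (j, False)
          + x (i, True) * x (j, True) * G (i, True) (j, True)))"
      by (intro sum.cong refl) (simp add: z_def G_def algebra_simps)
    also have "\<dots> = (\<Sum>s\<in>I. \<Sum>t\<in>I. x s * x t * G s t)"
      unfolding sumI by (simp only: sum.distrib)
    finally show "0 \<le> (\<Sum>s\<in>I. \<Sum>t\<in>I. x s * x t * G s t)" .
  qed
  moreover have "finite I" by (simp add: I_def)
  ultimately obtain \<alpha> where \<alpha>: "\<forall>s\<in>I. \<forall>t\<in>I. G s t = (\<Sum>u\<in>I. \<alpha> s u * \<alpha> t u)"
    using psd_on_factorization by blast
  \<comment> \<open>Both diagonal blocks of \<open>G\<close> contribute to each real part and both
    off-diagonal blocks to each imaginary part; dividing by \<open>sqrt 2\<close> averages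
    them.\<close>
  define \<phi> where "\<phi> = (\<lambda>t i. Complex (\<alpha> (i, False) t / sqrt 2) (\<alpha> (i, True) t / sqrt 2))"
  show ?thesis
  proof (rule that[of \<phi>])
    fix i j assume ij: "i < N" "j < N"
    have \<alpha>': "(\<Sum>u\<in>I. \<alpha> (i, a) u * \<alpha> (j, b) u) = G (i, a) (j, b)" for a b
      using \<alpha> ij by (simp add: I_def)
    have re: "Re (\<Sum>t\<in>I. \<phi> t i * cnj (\<phi> t j)) = Re (\<rho> $$ (i, j))"
    proof -
      have "Re (\<Sum>t\<in>I. \<phi> t i * cnj (\<phi> t j))
          = (\<Sum>t\<in>I. (\<alpha> (i, False) t * \<alpha> (j, False) t + \<alpha> (i, True) t * \<alpha> (j, True) t) / 2)"
        unfolding Re_sum by (intro sum.cong refl) (simp add: \<phi>_def add_divide_distrib)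
      also have "\<dots> = (G (i, False) (j, False) + G (i, True) (j, True)) / 2"
        unfolding sum_divide_distrib[symmetric] sum.distrib \<alpha>' ..
      finally show ?thesis by (simp add: G_def)
    qed
    have im: "Im (\<Sum>t\<in>I. \<phi> t i * cnj (\<phi> t j)) = Im (\<rho> $$ (i, j))"
    proof -
      have "Im (\<Sum>t\<in>I. \<phi> t i * cnj (\<phi> t j))
          = (\<Sum>t\<in>I. (\<alpha> (i, True) t * \<alpha> (j, False) t - \<alpha> (i, False) t * \<alpha> (j, True) t) / 2)"
        unfolding Im_sum by (intro sum.cong refl) (simp add: \<phi>_def diff_divide_distrib)
      also have "\<dots> = (G (i, True) (j, False) - G (i, False) (j, True)) / 2"
        unfolding sum_divide_distrib[symmetric] sum_subtractf \<alpha>' ..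
      finally show ?thesis by (simp add: G_def)
    qed
    show "\<rho> $$ (i, j) = (\<Sum>t\<in>{..<N} \<times> UNIV. \<phi> t i * cnj (\<phi> t j))"
      using re im unfolding I_def by (simp add: complex_eq_iff)
  qed
qed

section \<open>Tensor products and correlators in coordinates\<close>

lemma sum_lessThan_mult:
  fixes f :: "nat \<Rightarrow> 'a::comm_monoid_add"
  shows "(\<Sum>p<m * n. f p) = (\<Sum>a<m. \<Sum>b<n. f (a * n + b))"
proof -
  have "(\<Sum>a<m. \<Sum>b<n. f (a * n + b)) = (\<Sum>a<m. sum f {a * n..<a * n + n})"
  proof (rule sum.cong[OF refl])
    fix a
    show "(\<Sum>b<n. f (a * n + b)) = sum f {a * n..<a * n + n}"
      using sum.shift_bounds_nat_ivl[of f 0 "a * n" n] by (simp add: atLeast0LessThan add.commute)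
  qed
  then show ?thesis by (simp add: sum.nat_group)
qed

lemma mult_add_less:
  fixes a b m n :: nat
  assumes "a < m" "b < n"
  shows "a * n + b < m * n"
proof -
  have "a * n + b < Suc a * n" using assms by simp
  also have "\<dots> \<le> m * n" using assms by (intro mult_right_mono) auto
  finally show ?thesis .
qed

lemma kron_index:
  assumes "A \<in> carrier_mat n1 n1" "B \<in> carrier_mat n2 n2" "a < n1" "a' < n1" "b < n2" "b' < n2"
  shows "kron A B $$ (a * n2 + b, a' * n2 + b') = A $$ (a, a') * B $$ (b, b')"
  using assms by (simp add: kron_def mult_add_less)

lemma correlator_sum:
  assumes \<rho>: "\<rho> \<in> carrier_mat (n1 * n2) (n1 * n2)"
    and A: "A \<in> carrier_mat n1 n1" and B: "B \<in> carrier_mat n2 n2"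
  shows "correlator \<rho> A B = (\<Sum>a<n1. \<Sum>b<n2. \<Sum>a'<n1. \<Sum>b'<n2.
    \<rho> $$ (a * n2 + b, a' * n2 + b') * (A $$ (a', a) * B $$ (b', b)))"
proof -
  have K: "kron A B \<in> carrier_mat (n1 * n2) (n1 * n2)" using A B by (simp add: kron_def)
  have "correlator \<rho> A B = (\<Sum>p<n1 * n2. \<Sum>q<n1 * n2. \<rho> $$ (p, q) * kron A B $$ (q, p))"
    unfolding correlator_def mtrace_def using \<rho> K
    by (auto intro!: sum.cong simp: scalar_prod_def atLeast0LessThan)
  also have "\<dots> = (\<Sum>a<n1. \<Sum>b<n2. \<Sum>a'<n1. \<Sum>b'<n2.
      \<rho> $$ (a * n2 + b, a' * n2 + b') * kron A B $$ (a' * n2 + b', a * n2 + b))"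
    unfolding sum_lessThan_mult ..
  also have "\<dots> = (\<Sum>a<n1. \<Sum>b<n2. \<Sum>a'<n1. \<Sum>b'<n2.
      \<rho> $$ (a * n2 + b, a' * n2 + b') * (A $$ (a', a) * B $$ (b', b)))"
    by (intro sum.cong refl) (simp add: kron_index[OF A B])
  finally show ?thesis .
qed

text \<open>The correlator is the sum over \<open>t\<close> of the inner products of
  \<open>A\<close> on the first factor and \<open>B\<close> on the second, each applied to the same
  vector. Real and imaginary parts become separate coordinates, so the real inner product is the
  real part of the correlator.\<close>

lemma strategy_vectors:
  assumes "quantum_strategy M1 M2 n1 n2 \<rho> A1 A2"
  obtains T :: "((nat \<times> bool) \<times> nat \<times> nat \<times> bool) set"
    and x y :: "nat \<Rightarrow> (nat \<times> bool) \<times> nat \<times> nat \<times> bool \<Rightarrow> real"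
  where "finite T" "\<forall>i<M1. (\<Sum>\<tau>\<in>T. (x i \<tau>)\<^sup>2) \<le> 1" "\<forall>j<M2. (\<Sum>\<tau>\<in>T. (y j \<tau>)\<^sup>2) \<le> 1"
    "\<forall>i<M1. \<forall>j<M2. Re (correlator \<rho> (A1 i) (A2 j)) = (\<Sum>\<tau>\<in>T. x i \<tau> * y j \<tau>)"
proof -
  have obs1: "observable n1 (A1 i)" if "i < M1" for i
    using assms that by (simp add: quantum_strategy_def)
  have obs2: "observable n2 (A2 j)" if "j < M2" for j
    using assms that by (simp add: quantum_strategy_def)
  have dens: "density_op (n1 * n2) \<rho>" using assms by (simp add: quantum_strategy_def)
  then have \<rho>: "\<rho> \<in> carrier_mat (n1 * n2) (n1 * n2)" and tr: "mtrace \<rho> = 1"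
    unfolding density_op_def hermitian_mat_def by blast+
  obtain \<phi> :: "nat \<times> bool \<Rightarrow> nat \<Rightarrow> complex" where \<phi>:
    "\<And>i j. i < n1 * n2 \<Longrightarrow> j < n1 * n2 \<Longrightarrow>
      \<rho> $$ (i, j) = (\<Sum>t\<in>{..<n1 * n2} \<times> UNIV. \<phi> t i * cnj (\<phi> t j))"
    using density_factorization[OF dens] by blast
  define I where "I = {..<n1 * n2} \<times> (UNIV :: bool set)"
  define \<psi> where "\<psi> = (\<lambda>t a b. \<phi> t (a * n2 + b))"
  have \<psi>: "\<rho> $$ (a * n2 + b, a' * n2 + b') = (\<Sum>t\<in>I. \<psi> t a b * cnj (\<psi> t a' b'))"
    if "a < n1" "b < n2" "a' < n1" "b' < n2" for a b a' b'
    using \<phi>[OF mult_add_less mult_add_less] that by (simp add: \<psi>_def I_def)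
  \<comment> \<open>The total squared norm of the factor vectors is the trace of \<rho>.\<close>
  have mass: "(\<Sum>t\<in>I. \<Sum>a<n1. \<Sum>b<n2. (cmod (\<psi> t a b))\<^sup>2) = 1"
  proof -
    have "complex_of_real (\<Sum>t\<in>I. \<Sum>a<n1. \<Sum>b<n2. (cmod (\<psi> t a b))\<^sup>2)
        = (\<Sum>t\<in>I. \<Sum>a<n1. \<Sum>b<n2. \<psi> t a b * cnj (\<psi> t a b))"
      by (simp add: complex_norm_square del: of_real_power)
    also have "\<dots> = (\<Sum>a<n1. \<Sum>t\<in>I. \<Sum>b<n2. \<psi> t a b * cnj (\<psi> t a b))" by (rule sum.swap)
    also have "\<dots> = (\<Sum>a<n1. \<Sum>b<n2. \<Sum>t\<in>I. \<psi> t a b * cnj (\<psi> t a b))"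
      by (intro sum.cong refl sum.swap)
    also have "\<dots> = (\<Sum>a<n1. \<Sum>b<n2. \<rho> $$ (a * n2 + b, a * n2 + b))"
      by (intro sum.cong refl) (simp add: \<psi>)
    also have "\<dots> = mtrace \<rho>" using \<rho> by (simp add: mtrace_def sum_lessThan_mult)
    finally show ?thesis using tr by (metis of_real_eq_1_iff)
  qed
  define X where "X = (\<lambda>i t a b. apply_mat n1 (A1 i) (\<lambda>a'. \<psi> t a' b) a)"
  define Y where "Y = (\<lambda>j t a b. apply_mat n2 (A2 j) (\<psi> t a) b)"
  have X_le: "(\<Sum>t\<in>I. \<Sum>a<n1. \<Sum>b<n2. (cmod (X i t a b))\<^sup>2) \<le> 1" if "i < M1" for i
  proof -
    \<comment> \<open>\<open>A1 i\<close> acts on the first coordinate only, so the contraction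
      bound is applied separately for each fixed second coordinate \<open>b\<close>.\<close>
    have "(\<Sum>t\<in>I. \<Sum>a<n1. \<Sum>b<n2. (cmod (X i t a b))\<^sup>2)
        = (\<Sum>t\<in>I. \<Sum>b<n2. \<Sum>a<n1. (cmod (X i t a b))\<^sup>2)" by (intro sum.cong refl sum.swap)
    also have "\<dots> \<le> (\<Sum>t\<in>I. \<Sum>b<n2. \<Sum>a<n1. (cmod (\<psi> t a b))\<^sup>2)"
      unfolding X_def by (intro sum_mono observable_contraction[OF obs1[OF that]])
    also have "\<dots> = (\<Sum>t\<in>I. \<Sum>a<n1. \<Sum>b<n2. (cmod (\<psi> t a b))\<^sup>2)"
      by (intro sum.cong refl sum.swap)
    finally show ?thesis unfolding mass .
  qed
  have Y_le: "(\<Sum>t\<in>I. \<Sum>a<n1. \<Sum>b<n2. (cmod (Y j t a b))\<^sup>2) \<le> 1" if "j < M2" for j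
    unfolding mass[symmetric] Y_def by (intro sum_mono observable_contraction[OF obs2[OF that]])
  have corr: "correlator \<rho> (A1 i) (A2 j) = (\<Sum>t\<in>I. \<Sum>a<n1. \<Sum>b<n2. cnj (X i t a b) * Y j t a b)"
    if i: "i < M1" and j: "j < M2" for i j
  proof -
    have A: "A1 i \<in> carrier_mat n1 n1" and B: "A2 j \<in> carrier_mat n2 n2"
      and herm: "\<And>a a'. a < n1 \<Longrightarrow> a' < n1 \<Longrightarrow> A1 i $$ (a', a) = cnj (A1 i $$ (a, a'))"
      using obs1[OF i] obs2[OF j] unfolding observable_def hermitian_mat_def by blast+
    \<comment> \<open>Hermiticity turns \<open>A1 i\<close> at \<open>(a', a)\<close> into a
      conjugate at \<open>(a, a')\<close>. For fixed \<open>a\<close> and \<open>b'\<close> the sum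
      over \<open>a'\<close> and \<open>b\<close> then splits into the conjugate of \<open>X\<close>
      times \<open>Y\<close>; the sums are reordered to expose this.\<close>
    let ?F = "\<lambda>t a b a' b'. (cnj (A1 i $$ (a, a')) * cnj (\<psi> t a' b')) * (A2 j $$ (b', b) * \<psi> t a b)"
    have "correlator \<rho> (A1 i) (A2 j)
        = (\<Sum>a<n1. \<Sum>b<n2. \<Sum>a'<n1. \<Sum>b'<n2. \<Sum>t\<in>I. ?F t a b a' b')"
      unfolding correlator_sum[OF \<rho> A B]
    proof (intro sum.cong[OF refl])
      fix a b a' b' assume "a \<in> {..<n1}" "b \<in> {..<n2}" "a' \<in> {..<n1}" "b' \<in> {..<n2}"
      then have \<rho>t: "\<rho> $$ (a * n2 + b, a' * n2 + b') = (\<Sum>t\<in>I. \<psi> t a b * cnj (\<psi> t a' b'))"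
        and At: "A1 i $$ (a', a) = cnj (A1 i $$ (a, a'))"
        using \<psi> herm[of a a'] by auto
      show "\<rho> $$ (a * n2 + b, a' * n2 + b') * (A1 i $$ (a', a) * A2 j $$ (b', b))
          = (\<Sum>t\<in>I. ?F t a b a' b')"
        unfolding \<rho>t At sum_distrib_right by (intro sum.cong refl) (simp only: mult_ac)
    qed
    also have "\<dots> = (\<Sum>a<n1. \<Sum>b<n2. \<Sum>a'<n1. \<Sum>t\<in>I. \<Sum>b'<n2. ?F t a b a' b')"
      by (intro sum.cong refl sum.swap)
    also have "\<dots> = (\<Sum>a<n1. \<Sum>b<n2. \<Sum>t\<in>I. \<Sum>a'<n1. \<Sum>b'<n2. ?F t a b a' b')"
      by (intro sum.cong refl sum.swap)
    also have "\<dots> = (\<Sum>a<n1. \<Sum>t\<in>I. \<Sum>b<n2. \<Sum>a'<n1. \<Sum>b'<n2. ?F t a b a' b')"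
      by (intro sum.cong refl sum.swap)
    also have "\<dots> = (\<Sum>t\<in>I. \<Sum>a<n1. \<Sum>b<n2. \<Sum>a'<n1. \<Sum>b'<n2. ?F t a b a' b')"
      by (rule sum.swap)
    also have "\<dots> = (\<Sum>t\<in>I. \<Sum>a<n1. \<Sum>b<n2. \<Sum>b'<n2. \<Sum>a'<n1. ?F t a b a' b')"
      by (intro sum.cong refl sum.swap)
    also have "\<dots> = (\<Sum>t\<in>I. \<Sum>a<n1. \<Sum>b'<n2. \<Sum>b<n2. \<Sum>a'<n1. ?F t a b a' b')"
      by (intro sum.cong refl sum.swap)
    also have "\<dots> = (\<Sum>t\<in>I. \<Sum>a<n1. \<Sum>b'<n2. \<Sum>a'<n1. \<Sum>b<n2. ?F t a b a' b')"
      by (intro sum.cong refl sum.swap)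
    also have "\<dots> = (\<Sum>t\<in>I. \<Sum>a<n1. \<Sum>b'<n2. cnj (X i t a b') * Y j t a b')"
      by (simp only: X_def Y_def apply_mat_def sum_product cnj_sum complex_cnj_mult)
    finally show ?thesis .
  qed
  \<comment> \<open>The last component selects the real or the imaginary part.\<close>
  define T where "T = I \<times> {..<n1} \<times> {..<n2} \<times> (UNIV :: bool set)"
  define x where "x = (\<lambda>i (t, a, b, r). if r then Re (X i t a b) else Im (X i t a b))"
  define y where "y = (\<lambda>j (t, a, b, r). if r then Re (Y j t a b) else Im (Y j t a b))"
  have sumT: "(\<Sum>\<tau>\<in>T. f \<tau>)
      = (\<Sum>t\<in>I. \<Sum>a<n1. \<Sum>b<n2. f (t, a, b, True) + f (t, a, b, False))"
    for f :: "(nat \<times> bool) \<times> nat \<times> nat \<times> bool \<Rightarrow> real"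
  proof -
    have "(\<Sum>\<tau>\<in>T. f \<tau>) = (\<Sum>t\<in>I. \<Sum>a<n1. \<Sum>b<n2. \<Sum>r\<in>UNIV. f (t, a, b, r))"
      unfolding T_def sum.cartesian_product by simp
    then show ?thesis by (simp add: UNIV_bool add.commute)
  qed
  show ?thesis
  proof (rule that)
    show "finite T" by (simp add: T_def I_def)
    show "\<forall>i<M1. (\<Sum>\<tau>\<in>T. (x i \<tau>)\<^sup>2) \<le> 1"
      using X_le by (simp add: sumT x_def cmod_power2)
    show "\<forall>j<M2. (\<Sum>\<tau>\<in>T. (y j \<tau>)\<^sup>2) \<le> 1"
      using Y_le by (simp add: sumT y_def cmod_power2)
    show "\<forall>i<M1. \<forall>j<M2. Re (correlator \<rho> (A1 i) (A2 j)) = (\<Sum>\<tau>\<in>T. x i \<tau> * y j \<tau>)"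
      by (simp add: corr sumT x_def y_def)
  qed
qed

section \<open>From vectors to quantum strategies\<close>

text \<open>A linear family of real symmetric matrices with \<open>A\<^sub>v\<^sup>2 = \<parallel>v\<parallel>\<^sup>2\<close>, as in Tsirelson's construction.\<close>

fun clifford :: "nat \<Rightarrow> (nat \<Rightarrow> real) \<Rightarrow> complex mat" where
  "clifford 0 v = 0\<^sub>m 1 1"
| "clifford (Suc m) v = four_block_mat
     (clifford m v) (complex_of_real (v m) \<cdot>\<^sub>m 1\<^sub>m (2 ^ m))
     (complex_of_real (v m) \<cdot>\<^sub>m 1\<^sub>m (2 ^ m)) (- clifford m v)"

lemma clifford_carrier [simp]: "clifford m v \<in> carrier_mat (2 ^ m) (2 ^ m)"
  by (induction m) (auto intro!: carrier_matI simp: mult_2)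

lemma clifford_dim [simp]: "dim_row (clifford m v) = 2 ^ m" "dim_col (clifford m v) = 2 ^ m"
  using clifford_carrier by blast+

lemma clifford_real_symmetric:
  assumes "i < 2 ^ m" "j < 2 ^ m"
  shows "cnj (clifford m v $$ (i, j)) = clifford m v $$ (i, j)"
    and "clifford m v $$ (j, i) = clifford m v $$ (i, j)"
proof -
  have "cnj (clifford m v $$ (i, j)) = clifford m v $$ (i, j) \<and>
      clifford m v $$ (j, i) = clifford m v $$ (i, j)"
    using assms
  proof (induction m arbitrary: i j)
    case (Suc m)
    have "cnj (clifford m v $$ (i, j)) = clifford m v $$ (i, j)"
      "clifford m v $$ (j, i) = clifford m v $$ (i, j)" if "i < 2 ^ m" "j < 2 ^ m"
      using Suc.IH[OF that] by auto
    moreover have "cnj (clifford m v $$ (i - 2 ^ m, j - 2 ^ m)) = clifford m v $$ (i - 2 ^ m, j - 2 ^ m)"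
      "clifford m v $$ (j - 2 ^ m, i - 2 ^ m) = clifford m v $$ (i - 2 ^ m, j - 2 ^ m)"
      using Suc.IH[of "i - 2 ^ m" "j - 2 ^ m"] Suc.prems by auto
    ultimately show ?case using Suc.prems by (auto simp: mult_2)
  qed simp
  then show "cnj (clifford m v $$ (i, j)) = clifford m v $$ (i, j)"
    "clifford m v $$ (j, i) = clifford m v $$ (i, j)" by auto
qed

text \<open>The off-diagonal blocks change sign when \<open>v\<close> and \<open>w\<close> are
  exchanged, so they vanish in a square. The equal diagonal blocks double the trace at each
  level.\<close>

lemma clifford_mult_Suc:
  fixes v w :: "nat \<Rightarrow> real" and m :: nat
  defines "U \<equiv> clifford m v" and "Z \<equiv> clifford m w"
    and "a \<equiv> complex_of_real (v m)" and "b \<equiv> complex_of_real (w m)"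
  shows "clifford (Suc m) v * clifford (Suc m) w = four_block_mat
     (U * Z + (a * b) \<cdot>\<^sub>m 1\<^sub>m (2 ^ m)) (b \<cdot>\<^sub>m U - a \<cdot>\<^sub>m Z)
     (a \<cdot>\<^sub>m Z - b \<cdot>\<^sub>m U) (U * Z + (a * b) \<cdot>\<^sub>m 1\<^sub>m (2 ^ m))"
proof -
  have UZ: "U \<in> carrier_mat (2 ^ m) (2 ^ m)" "Z \<in> carrier_mat (2 ^ m) (2 ^ m)"
    by (simp_all add: U_def Z_def)
  have one: "k \<cdot>\<^sub>m 1\<^sub>m (2 ^ m) \<in> carrier_mat (2 ^ m) (2 ^ m)" for k :: complex by simp
  have scal: "(k \<cdot>\<^sub>m 1\<^sub>m (2 ^ m)) * B = k \<cdot>\<^sub>m B" "B * (k \<cdot>\<^sub>m 1\<^sub>m (2 ^ m)) = k \<cdot>\<^sub>m B"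
    if "B \<in> carrier_mat (2 ^ m) (2 ^ m)" for k :: complex and B
    using that mult_smult_assoc_mat[OF one_carrier_mat that] mult_smult_distrib[OF that one_carrier_mat]
    by simp_all
  have neg: "- U * - Z = U * Z" using UZ by (simp add: uminus_mult_right_mat uminus_mult_left_mat)
  have n: "- U \<in> carrier_mat (2 ^ m) (2 ^ m)" "- Z \<in> carrier_mat (2 ^ m) (2 ^ m)" using UZ by auto
  have "clifford (Suc m) v * clifford (Suc m) w =
     four_block_mat U (a \<cdot>\<^sub>m 1\<^sub>m (2 ^ m)) (a \<cdot>\<^sub>m 1\<^sub>m (2 ^ m)) (- U) *
     four_block_mat Z (b \<cdot>\<^sub>m 1\<^sub>m (2 ^ m)) (b \<cdot>\<^sub>m 1\<^sub>m (2 ^ m)) (- Z)"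
    by (simp add: U_def Z_def a_def b_def)
  also have "\<dots> = four_block_mat
     (U * Z + a \<cdot>\<^sub>m (b \<cdot>\<^sub>m 1\<^sub>m (2 ^ m))) (b \<cdot>\<^sub>m U + a \<cdot>\<^sub>m (- Z))
     (a \<cdot>\<^sub>m Z + b \<cdot>\<^sub>m (- U)) (a \<cdot>\<^sub>m (b \<cdot>\<^sub>m 1\<^sub>m (2 ^ m)) + U * Z)"
    unfolding mult_four_block_mat[OF UZ(1) one one n(1) UZ(2) one one n(2)]
    by (simp only: scal[OF UZ(1)] scal[OF UZ(2)] scal[OF n(1)] scal[OF n(2)] scal(1)[OF one] neg)
  also have "\<dots> = four_block_mat
     (U * Z + (a * b) \<cdot>\<^sub>m 1\<^sub>m (2 ^ m)) (b \<cdot>\<^sub>m U - a \<cdot>\<^sub>m Z)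
     (a \<cdot>\<^sub>m Z - b \<cdot>\<^sub>m U) (U * Z + (a * b) \<cdot>\<^sub>m 1\<^sub>m (2 ^ m))"
    by (rule cong_four_block_mat) (use UZ in \<open>auto intro!: eq_matI\<close>)
  finally show ?thesis .
qed

lemma clifford_square:
  "clifford m v * clifford m v = complex_of_real (\<Sum>t<m. (v t)\<^sup>2) \<cdot>\<^sub>m 1\<^sub>m (2 ^ m)"
proof (induction m)
  case (Suc m)
  have "clifford m v * clifford m v + (complex_of_real (v m) * complex_of_real (v m)) \<cdot>\<^sub>m 1\<^sub>m (2 ^ m)
      = complex_of_real (\<Sum>t<Suc m. (v t)\<^sup>2) \<cdot>\<^sub>m 1\<^sub>m (2 ^ m)"
    unfolding Suc by (auto intro!: eq_matI simp: power2_eq_square)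
  then show ?case
    unfolding clifford_mult_Suc
    by (auto intro!: eq_matI simp: mult_2)
qed auto

lemma mtrace_clifford_mult:
  "mtrace (clifford m v * clifford m w) = 2 ^ m * complex_of_real (\<Sum>t<m. v t * w t)"
proof (induction m)
  case 0
  then show ?case by (simp add: mtrace_def scalar_prod_def)
next
  case (Suc m)
  let ?D = "clifford m v * clifford m w + (complex_of_real (v m) * complex_of_real (w m)) \<cdot>\<^sub>m 1\<^sub>m (2 ^ m)"
  have split: "(\<Sum>i<k + l. f i) = (\<Sum>i<k. f i) + (\<Sum>i<l. f (k + i))"
    for f :: "nat \<Rightarrow> complex" and k l :: nat
    by (induction l) (simp_all add: add.assoc)
  have "mtrace (clifford (Suc m) v * clifford (Suc m) w) = 2 * (\<Sum>i<2 ^ m. ?D $$ (i, i))"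
    unfolding clifford_mult_Suc mtrace_def by (simp add: split)
  also have "(\<Sum>i<2 ^ m. ?D $$ (i, i))
      = mtrace (clifford m v * clifford m w) + 2 ^ m * (complex_of_real (v m) * complex_of_real (w m))"
    by (simp add: mtrace_def sum.distrib)
  finally show ?case by (simp add: Suc algebra_simps)
qed

text \<open>For a unit vector the matrix is an involution, so its eigenvalues square to 1.\<close>

lemma clifford_observable:
  assumes unit: "(\<Sum>t<m. (v t)\<^sup>2) = 1"
  shows "observable (2 ^ m) (clifford m v)"
proof -
  let ?A = "clifford m v"
  have sq: "?A * ?A = 1\<^sub>m (2 ^ m)" using clifford_square[of m v] unit by (auto intro!: eq_matI)
  have "\<exists>r::real. k = complex_of_real r \<and> -1 \<le> r \<and> r \<le> 1" if ev: "eigenvalue ?A k" for k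
  proof -
    obtain x where x: "x \<in> carrier_vec (2 ^ m)" "x \<noteq> 0\<^sub>v (2 ^ m)" "?A *\<^sub>v x = k \<cdot>\<^sub>v x"
      using ev unfolding eigenvalue_def eigenvector_def clifford_dim by blast
    have "x = (?A * ?A) *\<^sub>v x" using x sq by simp
    also have "\<dots> = ?A *\<^sub>v (?A *\<^sub>v x)" using x by (intro assoc_mult_mat_vec) auto
    also have "\<dots> = k \<cdot>\<^sub>v (k \<cdot>\<^sub>v x)"
      using x by (simp add: mult_mat_vec[OF clifford_carrier])
    finally have eq: "x = k \<cdot>\<^sub>v (k \<cdot>\<^sub>v x)" .
    obtain i where i: "i < 2 ^ m" "x $ i \<noteq> 0"
      using x(1,2) by (metis carrier_vecD eq_vecI index_zero_vec(1) index_zero_vec(2))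
    have "k * (k * x $ i) = (k \<cdot>\<^sub>v (k \<cdot>\<^sub>v x)) $ i" using i x(1) by simp
    also have "\<dots> = x $ i" by (rule arg_cong[OF eq[symmetric]])
    finally have "(k * k) * x $ i = 1 * x $ i" by (simp add: mult.assoc)
    then have "k * k = 1" using mult_right_cancel[OF i(2)] by blast
    then have "k = 1 \<or> k = -1" by (simp add: square_eq_1_iff)
    then show ?thesis
      by (elim disjE) (auto intro: exI[of _ "1::real"] exI[of _ "-1::real"])
  qed
  moreover have "hermitian_mat (2 ^ m) ?A"
    unfolding hermitian_mat_def using clifford_real_symmetric[of _ m _ v] by simp
  ultimately show ?thesis unfolding observable_def by blast
qed

text \<open>The projector onto the normalized sum of all \<open>e_a\<close> tensor
  \<open>e_a\<close>: with \<open>p = a * n + b\<close>, the condition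
  \<open>p div n = p mod n\<close> says \<open>a = b\<close>.\<close>

definition max_entangled :: "nat \<Rightarrow> complex mat" where
  "max_entangled n = mat (n * n) (n * n)
     (\<lambda>(p, q). of_bool (p div n = p mod n) * of_bool (q div n = q mod n) / of_nat n)"

lemma max_entangled_density:
  assumes n: "0 < n"
  shows "density_op (n * n) (max_entangled n)"
  unfolding density_op_def
proof (intro conjI ballI)
  show "hermitian_mat (n * n) (max_entangled n)"
    by (auto simp: hermitian_mat_def max_entangled_def)
  \<comment> \<open>The unnormalized entangled vector; the quadratic form at \<open>v\<close> is the
    squared modulus of its product with \<open>v\<close>, divided by \<open>n\<close>.\<close>
  define u :: "nat \<Rightarrow> complex" where "u = (\<lambda>p. of_bool (p div n = p mod n))"
  show "mtrace (max_entangled n) = 1"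
  proof -
    have "mtrace (max_entangled n) = (\<Sum>a<n. \<Sum>b<n. if b = a then 1 / of_nat n else 0)"
    proof -
      have "mtrace (max_entangled n) = (\<Sum>p<n * n. of_bool (p div n = p mod n) / of_nat n)"
        unfolding mtrace_def max_entangled_def by (intro sum.cong) auto
      then show ?thesis unfolding sum_lessThan_mult
        by (simp only:) (intro sum.cong refl, auto)
    qed
    also have "\<dots> = (\<Sum>a<n. 1 / of_nat n)" by (intro sum.cong refl) (simp only: sum.delta finite_lessThan if_True)
    also have "\<dots> = 1" using n by simp
    finally show ?thesis .
  qed
  fix v :: "complex vec" assume v: "v \<in> carrier_vec (n * n)"
  let ?s = "\<Sum>p<n * n. u p * v $ p"
  have "(\<Sum>p<n * n. cnj (v $ p) * (max_entangled n *\<^sub>v v) $ p)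
      = (\<Sum>p<n * n. \<Sum>q<n * n. (u p * cnj (v $ p)) * (u q * v $ q) / of_nat n)"
    using v unfolding max_entangled_def u_def
    by (intro sum.cong refl) (auto simp: scalar_prod_def atLeast0LessThan sum_distrib_left intro!: sum.cong)
  also have "\<dots> = (\<Sum>p<n * n. u p * cnj (v $ p)) * ?s / of_nat n"
    by (simp only: sum_product sum_divide_distrib)
  also have "(\<Sum>p<n * n. u p * cnj (v $ p)) = cnj ?s" by (simp add: u_def)
  also have "cnj ?s * ?s / of_nat n = complex_of_real ((cmod ?s)\<^sup>2 / real n)"
    by (simp add: complex_norm_square mult.commute del: of_real_power)
  finally have "(\<Sum>p<n * n. cnj (v $ p) * (max_entangled n *\<^sub>v v) $ p)
    = complex_of_real ((cmod ?s)\<^sup>2 / real n)" .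
  then show "0 \<le> Re (\<Sum>p<n * n. cnj (v $ p) * (max_entangled n *\<^sub>v v) $ p)" by simp
qed

text \<open>In this state the correlator is the trace of \<open>A\<close> times the transpose of
  \<open>B\<close>, over \<open>n\<close>; symmetry of \<open>B\<close> removes the
  transpose.\<close>

lemma max_entangled_correlator:
  assumes A: "A \<in> carrier_mat n n" and B: "B \<in> carrier_mat n n"
    and sym: "\<And>a b. a < n \<Longrightarrow> b < n \<Longrightarrow> B $$ (b, a) = B $$ (a, b)"
  shows "correlator (max_entangled n) A B = mtrace (A * B) / of_nat n"
proof -
  have "correlator (max_entangled n) A B = (\<Sum>a<n. \<Sum>b<n. \<Sum>a'<n. \<Sum>b'<n.
      max_entangled n $$ (a * n + b, a' * n + b') * (A $$ (a', a) * B $$ (b', b)))"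
    by (rule correlator_sum[OF _ A B]) (simp add: max_entangled_def)
  also have "\<dots> = (\<Sum>a<n. \<Sum>b<n. \<Sum>a'<n. \<Sum>b'<n.
      if b' = a' then if b = a then A $$ (a', a) * B $$ (b', b) / of_nat n else 0 else 0)"
    by (intro sum.cong refl) (auto simp: max_entangled_def mult_add_less)
  also have "\<dots> = (\<Sum>a<n. \<Sum>b<n. if b = a then \<Sum>a'<n. A $$ (a', a) * B $$ (a', b) / of_nat n else 0)"
    by (intro sum.cong refl) auto
  also have "\<dots> = (\<Sum>a<n. \<Sum>a'<n. A $$ (a', a) * B $$ (a', a) / of_nat n)" by simp
  also have "\<dots> = (\<Sum>a'<n. \<Sum>a<n. A $$ (a', a) * B $$ (a', a) / of_nat n)" by (rule sum.swap)
  also have "\<dots> = (\<Sum>a'<n. \<Sum>a<n. A $$ (a', a) * B $$ (a, a') / of_nat n)"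
    using sym by (intro sum.cong refl) auto
  also have "\<dots> = mtrace (A * B) / of_nat n"
    unfolding mtrace_def sum_divide_distrib using A B
    by (auto simp: scalar_prod_def atLeast0LessThan sum_divide_distrib intro!: sum.cong)
  finally show ?thesis .
qed

text \<open>The trace of a product of Clifford matrices is the inner product times
  \<open>2 ^ m\<close>, and the state divides by exactly this dimension.\<close>

lemma tsirelson_strategy:
  fixes m :: nat and x y :: "nat \<Rightarrow> nat \<Rightarrow> real"
  assumes x: "\<forall>i<M1. (\<Sum>t<m. (x i t)\<^sup>2) = 1" and y: "\<forall>j<M2. (\<Sum>t<m. (y j t)\<^sup>2) = 1"
  shows "\<exists>n1 n2 \<rho> A1 A2. quantum_strategy M1 M2 n1 n2 \<rho> A1 A2 \<and>
    (\<forall>i<M1. \<forall>j<M2. correlator \<rho> (A1 i) (A2 j) = complex_of_real (\<Sum>t<m. x i t * y j t))"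
proof (intro exI conjI allI impI)
  show "quantum_strategy M1 M2 (2 ^ m) (2 ^ m) (max_entangled (2 ^ m))
      (\<lambda>i. clifford m (x i)) (\<lambda>j. clifford m (y j))"
    using x y max_entangled_density[of "2 ^ m"] by (simp add: quantum_strategy_def clifford_observable)
  fix i j
  show "correlator (max_entangled (2 ^ m)) (clifford m (x i)) (clifford m (y j))
      = complex_of_real (\<Sum>t<m. x i t * y j t)"
    by (subst max_entangled_correlator[OF clifford_carrier clifford_carrier])
      (simp_all add: clifford_real_symmetric(2) mtrace_clifford_mult)
qed

section \<open>Matrices in singular value form\<close>

text \<open>Connects the multiplicity \<open>d\<close>, a cardinality, with the first
  \<open>d\<close> columns: for nonincreasing singular values the indices of the largest one form an
  initial segment.\<close>

lemma downward_closed_eq_lessThan_card: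
  fixes A :: "nat set"
  assumes "finite A" "\<And>k l. l \<in> A \<Longrightarrow> k \<le> l \<Longrightarrow> k \<in> A"
  shows "A = {..<card A}"
proof (rule card_seteq)
  show "A \<subseteq> {..<card A}"
  proof
    fix l assume "l \<in> A"
    then have "{..l} \<subseteq> A" using assms(2) by auto
    then have "card {..l} \<le> card A" by (rule card_mono[OF assms(1)])
    then show "l \<in> {..<card A}" by simp
  qed
qed simp_all

lemma mult_transpose_index:
  assumes "A \<in> carrier_mat m n" "B \<in> carrier_mat l n" "i < m" "j < l"
  shows "(A * transpose_mat B) $$ (i, j) = (\<Sum>k<n. A $$ (i, k) * B $$ (j, k))"
  using assms by (auto simp: scalar_prod_def atLeast0LessThan intro!: sum.cong)

text \<open>A left inverse of a square matrix is also a right inverse, so orthonormal columns give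
  orthonormal rows.\<close>

lemma orthogonal_mat_rows:
  fixes V :: "real mat"
  assumes V: "V \<in> carrier_mat n n" "transpose_mat V * V = 1\<^sub>m n" and i: "i < n" "j < n"
  shows "(\<Sum>k<n. V $$ (i, k) * V $$ (j, k)) = (if i = j then 1 else 0)"
    and "(\<Sum>k<n. V $$ (k, i) * V $$ (k, j)) = (if i = j then 1 else 0)"
proof -
  have "V * transpose_mat V = 1\<^sub>m n"
    using mat_mult_left_right_inverse[OF _ V(1) V(2)] V(1) by simp
  then show "(\<Sum>k<n. V $$ (i, k) * V $$ (j, k)) = (if i = j then 1 else 0)"
    using mult_transpose_index[OF V(1) V(1) i] i by simp
  have "(transpose_mat V * V) $$ (i, j) = (\<Sum>k<n. V $$ (k, i) * V $$ (k, j))"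
    using V(1) i by (auto simp: scalar_prod_def atLeast0LessThan intro!: sum.cong)
  then show "(\<Sum>k<n. V $$ (k, i) * V $$ (k, j)) = (if i = j then 1 else 0)"
    using V(2) i by simp
qed

lemma svd_index:
  fixes V S W :: "real mat"
  assumes V: "V \<in> carrier_mat M1 M1" and W: "W \<in> carrier_mat M2 M2"
    and S: "S \<in> carrier_mat M1 M2" "diagonal_mat S" and i: "i < M1" and j: "j < M2"
  shows "(V * S * transpose_mat W) $$ (i, j)
    = (\<Sum>k<min M1 M2. V $$ (i, k) * S $$ (k, k) * W $$ (j, k))"
proof -
  have VS: "(V * S) $$ (i, b) = (if b < M1 then V $$ (i, b) * S $$ (b, b) else 0)" if b: "b < M2" for b
  proof -
    have "(V * S) $$ (i, b) = (\<Sum>a<M1. V $$ (i, a) * S $$ (a, b))"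
      using V S i b by (auto simp: scalar_prod_def atLeast0LessThan intro!: sum.cong)
    also have "\<dots> = (\<Sum>a<M1. if a = b then V $$ (i, b) * S $$ (b, b) else 0)"
      using S b by (intro sum.cong refl) (auto simp: diagonal_mat_def)
    also have "\<dots> = (if b < M1 then V $$ (i, b) * S $$ (b, b) else 0)" by simp
    finally show ?thesis .
  qed
  have "V * S \<in> carrier_mat M1 M2" using V S by simp
  then have "(V * S * transpose_mat W) $$ (i, j) = (\<Sum>b<M2. (V * S) $$ (i, b) * W $$ (j, b))"
    using W i j by (intro mult_transpose_index) auto
  also have "\<dots> = (\<Sum>b<M2. if b < M1 then V $$ (i, b) * S $$ (b, b) * W $$ (j, b) else 0)"
    by (intro sum.cong refl) (simp add: VS)
  also have "\<dots> = (\<Sum>k<min M1 M2. V $$ (i, k) * S $$ (k, k) * W $$ (j, k))"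
    by (intro sum.mono_neutral_cong_right) auto
  finally show ?thesis .
qed

lemma svd_matrices:
  fixes g V S W :: "real mat"
  assumes g: "g \<in> carrier_mat M1 M2" and g_nz: "g \<noteq> 0\<^sub>m M1 M2"
    and V: "V \<in> carrier_mat M1 M1" "transpose_mat V * V = 1\<^sub>m M1"
    and W: "W \<in> carrier_mat M2 M2" "transpose_mat W * W = 1\<^sub>m M2"
    and S: "S \<in> carrier_mat M1 M2" "diagonal_mat S"
    and S_nonneg: "\<forall>k < min M1 M2. 0 \<le> S $$ (k, k)"
    and S_noninc: "\<forall>k l. k \<le> l \<and> l < min M1 M2 \<longrightarrow> S $$ (l, l) \<le> S $$ (k, k)"
    and svd: "g = V * S * transpose_mat W"
  shows "svd M1 M2 (card {k. k < min M1 M2 \<and> S $$ (k, k) = S $$ (0, 0)})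
    (\<lambda>i k. V $$ (i, k)) (\<lambda>j k. W $$ (j, k)) (\<lambda>i j. g $$ (i, j))
    (\<lambda>k. if k < min M1 M2 then S $$ (k, k) else 0) (S $$ (0, 0))"
proof -
  obtain i j where ij: "i < M1" "j < M2" "g $$ (i, j) \<noteq> 0"
    using g g_nz by (metis carrier_matD eq_matI index_zero_mat)
  then have M: "0 < M1" "0 < M2" by auto
  have g_sum: "g $$ (i, j) = (\<Sum>k<min M1 M2. V $$ (i, k) * S $$ (k, k) * W $$ (j, k))"
    if "i < M1" "j < M2" for i j
    unfolding svd by (rule svd_index[OF V(1) W(1) S that])
  \<comment> \<open>Otherwise monotonicity and nonnegativity make every singular value 0, and then
    \<open>g\<close> vanishes.\<close>
  have \<sigma>: "0 < S $$ (0, 0)"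
  proof (rule ccontr)
    assume "\<not> 0 < S $$ (0, 0)"
    then have "S $$ (k, k) = 0" if "k < min M1 M2" for k
      using S_nonneg S_noninc that by (metis le0 order.antisym order.trans not_less)
    then have "g $$ (i, j) = 0" using g_sum[OF ij(1,2)] by simp
    with ij(3) show False ..
  qed
  define D where "D = {k. k < min M1 M2 \<and> S $$ (k, k) = S $$ (0, 0)}"
  have "finite D" by (simp add: D_def)
  moreover have "k \<in> D" if l: "l \<in> D" and "k \<le> l" for k l
  proof -
    have k: "k < min M1 M2" using that by (auto simp: D_def)
    have "S $$ (l, l) \<le> S $$ (k, k)" using S_noninc that unfolding D_def by blast
    moreover have "S $$ (k, k) \<le> S $$ (0, 0)" using S_noninc k by blast
    moreover note k
    ultimately show ?thesis using l by (simp add: D_def)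
  qed
  ultimately have D: "D = {..<card D}" by (rule downward_closed_eq_lessThan_card)
  then have D_iff: "k < card D \<longleftrightarrow> k < min M1 M2 \<and> S $$ (k, k) = S $$ (0, 0)" for k
    by (auto simp: D_def)
  show ?thesis
    unfolding D_def[symmetric]
  proof
    show "card D \<le> min M1 M2" using D_iff by (meson leI less_irrefl)
    show "(if k < min M1 M2 then S $$ (k, k) else 0) < S $$ (0, 0)" if "card D \<le> k" for k
    proof -
      have "S $$ (k, k) \<noteq> S $$ (0, 0)" if "k < min M1 M2"
        using D_iff[of k] that \<open>card D \<le> k\<close> by simp
      moreover have "S $$ (k, k) \<le> S $$ (0, 0)" if "k < min M1 M2" using S_noninc that by blast
      ultimately show ?thesis using \<sigma> by (cases "k < min M1 M2") (simp_all del: min_less_iff_conj)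
    qed
  qed (use M \<sigma> D_iff S_nonneg orthogonal_mat_rows[OF V] orthogonal_mat_rows[OF W] g_sum in auto)
qed

section \<open>Translation to matrices and proof of the equivalences\<close>

lemma transpose_mult_row:
  fixes V \<alpha> :: "real mat"
  assumes "\<alpha> \<in> carrier_mat d e" "i < n"
  shows "transpose_mat \<alpha> *\<^sub>v row (mat n d (\<lambda>(i, k). V $$ (i, k))) i
    = vec e (\<lambda>t. \<Sum>k<d. V $$ (i, k) * \<alpha> $$ (k, t))"
  using assms by (intro eq_vecI)
    (auto simp: scalar_prod_def atLeast0LessThan mult.commute intro!: sum.cong)

lemma vec_scalar_prod: "vec n x \<bullet> vec n y = (\<Sum>t<n. x t * y t)"
  by (simp add: scalar_prod_def atLeast0LessThan)

lemma scalar_prod_index: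
  assumes "y \<in> carrier_vec n"
  shows "x \<bullet> y = (\<Sum>t<n. x $ t * y $ t)"
  using assms by (simp add: scalar_prod_def atLeast0LessThan)

text \<open>As \<open>V\<close> and \<open>W\<close> are orthogonal and the diagonal of
  \<open>S\<close> is nonnegative and nonincreasing, \<open>S $$ (0, 0)\<close> is the largest
  singular value of \<open>g\<close>. Correlators are complex, so attainment of the bound is an
  equation of complex numbers.\<close>

theorem theorem2:
  fixes M1 M2 :: nat and g V S W :: "real mat"
  assumes g: "g \<in> carrier_mat M1 M2" and g_nz: "g \<noteq> 0\<^sub>m M1 M2"
    and V: "V \<in> carrier_mat M1 M1" "transpose_mat V * V = 1\<^sub>m M1"
    and W: "W \<in> carrier_mat M2 M2" "transpose_mat W * W = 1\<^sub>m M2"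
    and S: "S \<in> carrier_mat M1 M2" "diagonal_mat S"
    and S_nonneg: "\<forall>k < min M1 M2. 0 \<le> S $$ (k, k)"
    and S_noninc: "\<forall>k l. k \<le> l \<and> l < min M1 M2 \<longrightarrow> S $$ (l, l) \<le> S $$ (k, k)"
    and svd: "g = V * S * transpose_mat W"
  shows
    "let \<sigma> = S $$ (0, 0);
         d = card {k. k < min M1 M2 \<and> S $$ (k, k) = \<sigma>};
         Vd = mat M1 d (\<lambda>(i, k). V $$ (i, k));
         Wd = mat M2 d (\<lambda>(j, k). W $$ (j, k));
         condA = (\<lambda>d'. \<exists>v w. (\<forall>i<M1. v i \<in> carrier_vec d' \<and> v i \<bullet> v i = 1) \<and>
                            (\<forall>j<M2. w j \<in> carrier_vec d' \<and> w j \<bullet> w j = 1) \<and>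
                            (\<Sum>i<M1. \<Sum>j<M2. g $$ (i, j) * (v i \<bullet> w j)) = sqrt (real (M1 * M2)) * \<sigma>);
         condB = (\<lambda>d' \<alpha>. \<alpha> \<in> carrier_mat d d' \<and>
                   (\<forall>i<M1. (transpose_mat \<alpha> *\<^sub>v row Vd i) \<bullet> (transpose_mat \<alpha> *\<^sub>v row Vd i) = 1) \<and>
                   (\<forall>j<M2. (transpose_mat \<alpha> *\<^sub>v row Wd j) \<bullet> (transpose_mat \<alpha> *\<^sub>v row Wd j)
                            = real M1 / real M2));
         vv = (\<lambda>\<alpha> i. transpose_mat \<alpha> *\<^sub>v row Vd i);
         ww = (\<lambda>\<alpha> j. sqrt (real M2 / real M1) \<cdot>\<^sub>v (transpose_mat \<alpha> *\<^sub>v row Wd j))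
     in (\<forall>d'. 1 \<le> d' \<and> d' \<le> d \<longrightarrow> (condA d' \<longleftrightarrow> (\<exists>\<alpha>. condB d' \<alpha>)))
      \<and> (\<forall>d' \<alpha>. 1 \<le> d' \<and> d' \<le> d \<and> condB d' \<alpha> \<longrightarrow>
            (\<forall>i<M1. vv \<alpha> i \<in> carrier_vec d' \<and> vv \<alpha> i \<bullet> vv \<alpha> i = 1) \<and>
            (\<forall>j<M2. ww \<alpha> j \<in> carrier_vec d' \<and> ww \<alpha> j \<bullet> ww \<alpha> j = 1) \<and>
            (\<Sum>i<M1. \<Sum>j<M2. g $$ (i, j) * (vv \<alpha> i \<bullet> ww \<alpha> j)) = sqrt (real (M1 * M2)) * \<sigma>)
      \<and> ((\<exists>n1 n2 \<rho> A1 A2. quantum_strategy M1 M2 n1 n2 \<rho> A1 A2 \<and>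
            (\<Sum>i<M1. \<Sum>j<M2. complex_of_real (g $$ (i, j)) * correlator \<rho> (A1 i) (A2 j))
              = complex_of_real (sqrt (real (M1 * M2)) * \<sigma>))
         \<longleftrightarrow> (\<exists>d' \<alpha>. 1 \<le> d' \<and> d' \<le> d \<and> condB d' \<alpha>))
      \<and> (\<forall>d' \<alpha>. 1 \<le> d' \<and> d' \<le> d \<and> condB d' \<alpha> \<longrightarrow>
            (\<exists>n1 n2 \<rho> A1 A2. quantum_strategy M1 M2 n1 n2 \<rho> A1 A2 \<and>
               (\<forall>i<M1. \<forall>j<M2. correlator \<rho> (A1 i) (A2 j) = complex_of_real (vv \<alpha> i \<bullet> ww \<alpha> j)) \<and>
               (\<Sum>i<M1. \<Sum>j<M2. complex_of_real (g $$ (i, j)) * correlator \<rho> (A1 i) (A2 j))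
                 = complex_of_real (sqrt (real (M1 * M2)) * \<sigma>)))"
proof -
  define \<sigma> where "\<sigma> = S $$ (0, 0)"
  define d where "d = card {k. k < min M1 M2 \<and> S $$ (k, k) = \<sigma>}"
  define Vd where "Vd = mat M1 d (\<lambda>(i, k). V $$ (i, k))"
  define Wd where "Wd = mat M2 d (\<lambda>(j, k). W $$ (j, k))"
  define condA where "condA = (\<lambda>d'. \<exists>v w. (\<forall>i<M1. v i \<in> carrier_vec d' \<and> v i \<bullet> v i = 1) \<and>
    (\<forall>j<M2. w j \<in> carrier_vec d' \<and> w j \<bullet> w j = 1) \<and>
    (\<Sum>i<M1. \<Sum>j<M2. g $$ (i, j) * (v i \<bullet> w j)) = sqrt (real (M1 * M2)) * \<sigma>)"
  define condB where "condB = (\<lambda>d' \<alpha>. \<alpha> \<in> carrier_mat d d' \<and>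
    (\<forall>i<M1. (transpose_mat \<alpha> *\<^sub>v row Vd i) \<bullet> (transpose_mat \<alpha> *\<^sub>v row Vd i) = 1) \<and>
    (\<forall>j<M2. (transpose_mat \<alpha> *\<^sub>v row Wd j) \<bullet> (transpose_mat \<alpha> *\<^sub>v row Wd j) = real M1 / real M2))"
  define vv where "vv = (\<lambda>\<alpha> i. transpose_mat \<alpha> *\<^sub>v row Vd i)"
  define ww where "ww = (\<lambda>\<alpha> j. sqrt (real M2 / real M1) \<cdot>\<^sub>v (transpose_mat \<alpha> *\<^sub>v row Wd j))"
  note defs = \<sigma>_def d_def Vd_def Wd_def condA_def condB_def vv_def ww_def
  define s where "s = (\<lambda>k. if k < min M1 M2 then S $$ (k, k) else 0)"
  interpret svd M1 M2 d "\<lambda>i k. V $$ (i, k)" "\<lambda>j k. W $$ (j, k)" "\<lambda>i j. g $$ (i, j)" s \<sigma>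
    unfolding s_def d_def \<sigma>_def by (rule svd_matrices[OF assms])
  \<comment> \<open>Ensures that \<open>d' = d\<close> is an admissible choice when a quantum
    strategy is reduced to condition (b).\<close>
  have d_pos: "1 \<le> d"
  proof -
    have "0 \<in> {k. k < min M1 M2 \<and> S $$ (k, k) = \<sigma>}" using M1 M2 by (simp add: \<sigma>_def)
    then have "0 < d" unfolding d_def by (subst card_gt_0_iff) auto
    then show ?thesis by simp
  qed
  have vv_vec: "vv \<alpha> i = vec d' (\<lambda>t. \<Sum>k<d. V $$ (i, k) * \<alpha> $$ (k, t))"
    if "\<alpha> \<in> carrier_mat d d'" "i < M1" for \<alpha> d' i
    unfolding vv_def Vd_def by (rule transpose_mult_row[OF that])
  have wd_vec: "transpose_mat \<alpha> *\<^sub>v row Wd j = vec d' (\<lambda>t. \<Sum>k<d. W $$ (j, k) * \<alpha> $$ (k, t))"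
    if "\<alpha> \<in> carrier_mat d d'" "j < M2" for \<alpha> d' j
    unfolding Wd_def by (rule transpose_mult_row[OF that])
  have ww_vec: "ww \<alpha> j = vec d' (\<lambda>t. c * (\<Sum>k<d. W $$ (j, k) * \<alpha> $$ (k, t)))"
    if "\<alpha> \<in> carrier_mat d d'" "j < M2" for \<alpha> d' j
    unfolding ww_def wd_vec[OF that] c_def by auto
  have condB_iff: "condB d' \<alpha> \<longleftrightarrow> \<alpha> \<in> carrier_mat d d' \<and> feasible {..<d'} (\<lambda>k t. \<alpha> $$ (k, t))" for d' \<alpha>
  proof (cases "\<alpha> \<in> carrier_mat d d'")
    case True
    then show ?thesis
      by (simp add: condB_def feasible_def vv_vec[unfolded vv_def] wd_vec vec_scalar_prod power2_eq_square)
  qed (simp add: condB_def)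
  have condB_mat: "condB d' (mat d d' (\<lambda>(k, t). \<beta> k t))" if "feasible {..<d'} \<beta>" for d' \<beta>
    using that by (simp add: condB_iff feasible_def)
  have strong: "(\<forall>i<M1. vv \<alpha> i \<in> carrier_vec d' \<and> vv \<alpha> i \<bullet> vv \<alpha> i = 1) \<and>
      (\<forall>j<M2. ww \<alpha> j \<in> carrier_vec d' \<and> ww \<alpha> j \<bullet> ww \<alpha> j = 1) \<and>
      (\<Sum>i<M1. \<Sum>j<M2. g $$ (i, j) * (vv \<alpha> i \<bullet> ww \<alpha> j)) = sqrt (real (M1 * M2)) * \<sigma>"
    if B: "condB d' \<alpha>" for d' \<alpha>
  proof -
    have \<alpha>: "\<alpha> \<in> carrier_mat d d'" and F: "feasible {..<d'} (\<lambda>k t. \<alpha> $$ (k, t))"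
      using B condB_iff by auto
    have "vv \<alpha> i \<in> carrier_vec d' \<and> vv \<alpha> i \<bullet> vv \<alpha> i = 1" if "i < M1" for i
    proof
      show "vv \<alpha> i \<in> carrier_vec d'" unfolding vv_vec[OF \<alpha> that] by simp
      show "vv \<alpha> i \<bullet> vv \<alpha> i = 1" using B that unfolding condB_def vv_def by blast
    qed
    moreover have "ww \<alpha> j \<in> carrier_vec d' \<and> ww \<alpha> j \<bullet> ww \<alpha> j = 1" if j: "j < M2" for j
    proof -
      let ?u = "\<lambda>t. \<Sum>k<d. W $$ (j, k) * \<alpha> $$ (k, t)"
      have "ww \<alpha> j \<bullet> ww \<alpha> j = (\<Sum>t<d'. c\<^sup>2 * (?u t)\<^sup>2)"
        unfolding ww_vec[OF \<alpha> j] vec_scalar_prod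
        by (intro sum.cong refl) (simp only: power2_eq_square mult_ac)
      also have "\<dots> = c\<^sup>2 * (real M1 / real M2)"
        unfolding sum_distrib_left[symmetric] using F j by (simp add: feasible_def)
      also have "\<dots> = 1" using M1 M2 by (simp add: c_square)
      finally show ?thesis by (simp add: ww_vec[OF \<alpha> j])
    qed
    moreover have "(\<Sum>i<M1. \<Sum>j<M2. g $$ (i, j) * (vv \<alpha> i \<bullet> ww \<alpha> j)) = sqrt (real (M1 * M2)) * \<sigma>"
      unfolding feasible_imp_optimal[OF F, symmetric]
      by (intro sum.cong refl) (simp add: vv_vec[OF \<alpha>] ww_vec[OF \<alpha>] vec_scalar_prod)
    ultimately show ?thesis by blast
  qed
  have part1: "condA d' \<longleftrightarrow> (\<exists>\<alpha>. condB d' \<alpha>)" for d'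
  proof
    assume "condA d'"
    then obtain v w where vw: "\<forall>i<M1. v i \<in> carrier_vec d' \<and> v i \<bullet> v i = 1"
      "\<forall>j<M2. w j \<in> carrier_vec d' \<and> w j \<bullet> w j = 1"
      "(\<Sum>i<M1. \<Sum>j<M2. g $$ (i, j) * (v i \<bullet> w j)) = sqrt (real (M1 * M2)) * \<sigma>"
      unfolding condA_def by blast
    have unit: "(\<Sum>t\<in>{..<d'}. (u $ t)\<^sup>2) = u \<bullet> u" if "u \<in> carrier_vec d'" for u :: "real vec"
      by (simp add: scalar_prod_index[OF that] power2_eq_square)
    have "(\<Sum>i<M1. \<Sum>j<M2. g $$ (i, j) * (\<Sum>t\<in>{..<d'}. v i $ t * w j $ t))
        = (\<Sum>i<M1. \<Sum>j<M2. g $$ (i, j) * (v i \<bullet> w j))"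
      using vw(2) by (intro sum.cong refl) (simp add: scalar_prod_index[of _ d'])
    then have "feasible {..<d'} (\<lambda>k t. \<Sum>i<M1. V $$ (i, k) * v i $ t)"
      using vw by (intro optimal_imp_feasible[of _ _ "\<lambda>j t. w j $ t"]) (auto simp: unit)
    then show "\<exists>\<alpha>. condB d' \<alpha>" using condB_mat by blast
  next
    assume "\<exists>\<alpha>. condB d' \<alpha>"
    then obtain \<alpha> where "condB d' \<alpha>" ..
    then show "condA d'" unfolding condA_def using strong by blast
  qed
  have part4: "\<exists>n1 n2 \<rho> A1 A2. quantum_strategy M1 M2 n1 n2 \<rho> A1 A2 \<and>
      (\<forall>i<M1. \<forall>j<M2. correlator \<rho> (A1 i) (A2 j) = complex_of_real (vv \<alpha> i \<bullet> ww \<alpha> j)) \<and>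
      (\<Sum>i<M1. \<Sum>j<M2. complex_of_real (g $$ (i, j)) * correlator \<rho> (A1 i) (A2 j))
        = complex_of_real (sqrt (real (M1 * M2)) * \<sigma>)"
    if B: "condB d' \<alpha>" for d' \<alpha>
  proof -
    note st = strong[OF B]
    have "\<exists>n1 n2 \<rho> A1 A2. quantum_strategy M1 M2 n1 n2 \<rho> A1 A2 \<and>
      (\<forall>i<M1. \<forall>j<M2. correlator \<rho> (A1 i) (A2 j) = complex_of_real (\<Sum>t<d'. vv \<alpha> i $ t * ww \<alpha> j $ t))"
      using st by (intro tsirelson_strategy) (auto simp: scalar_prod_index[of _ d'] power2_eq_square)
    then obtain n1 n2 \<rho> A1 A2 where Q: "quantum_strategy M1 M2 n1 n2 \<rho> A1 A2"
      and E: "\<forall>i<M1. \<forall>j<M2. correlator \<rho> (A1 i) (A2 j) = complex_of_real (vv \<alpha> i \<bullet> ww \<alpha> j)"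
      using st by (auto simp: scalar_prod_index[of _ d'])
    have "(\<Sum>i<M1. \<Sum>j<M2. complex_of_real (g $$ (i, j)) * correlator \<rho> (A1 i) (A2 j))
        = complex_of_real (\<Sum>i<M1. \<Sum>j<M2. g $$ (i, j) * (vv \<alpha> i \<bullet> ww \<alpha> j))"
      using E by simp
    also have "\<dots> = complex_of_real (sqrt (real (M1 * M2)) * \<sigma>)" using st by simp
    finally show ?thesis using Q E by blast
  qed
  have part3: "\<exists>d' \<alpha>. 1 \<le> d' \<and> d' \<le> d \<and> condB d' \<alpha>"
    if Q: "quantum_strategy M1 M2 n1 n2 \<rho> A1 A2"
      and eq: "(\<Sum>i<M1. \<Sum>j<M2. complex_of_real (g $$ (i, j)) * correlator \<rho> (A1 i) (A2 j))
        = complex_of_real (sqrt (real (M1 * M2)) * \<sigma>)" for n1 n2 \<rho> A1 A2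
  proof -
    obtain T :: "((nat \<times> bool) \<times> nat \<times> nat \<times> bool) set" and x y where T: "finite T"
      and x: "\<forall>i<M1. (\<Sum>\<tau>\<in>T. (x i \<tau>)\<^sup>2) \<le> 1" and y: "\<forall>j<M2. (\<Sum>\<tau>\<in>T. (y j \<tau>)\<^sup>2) \<le> 1"
      and E: "\<forall>i<M1. \<forall>j<M2. Re (correlator \<rho> (A1 i) (A2 j)) = (\<Sum>\<tau>\<in>T. x i \<tau> * y j \<tau>)"
      using strategy_vectors[OF Q] by blast
    \<comment> \<open>The vectors reproduce only the real parts of the correlators; taking real
      parts of \<open>eq\<close> is enough because \<open>g\<close> is real.\<close>
    have "(\<Sum>i<M1. \<Sum>j<M2. g $$ (i, j) * (\<Sum>\<tau>\<in>T. x i \<tau> * y j \<tau>))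
        = Re (\<Sum>i<M1. \<Sum>j<M2. complex_of_real (g $$ (i, j)) * correlator \<rho> (A1 i) (A2 j))"
      using E by simp
    also have "\<dots> = sqrt (real (M1 * M2)) * \<sigma>" unfolding eq by (rule Re_complex_of_real)
    finally have "feasible T (\<lambda>k \<tau>. \<Sum>i<M1. V $$ (i, k) * x i \<tau>)"
      by (rule optimal_imp_feasible[OF T x y])
    \<comment> \<open>The index set \<open>T\<close> depends on the Hilbert space dimensions;
      passing through the Gram matrix replaces it by \<open>{..<d}\<close>, so \<open>d' = d\<close>
      is the witness.\<close>
    then obtain \<beta> where "feasible {..<d} \<beta>" using feasible_reduce by blast
    then show ?thesis using condB_mat d_pos by blast
  qed
  have "(\<forall>d'. 1 \<le> d' \<and> d' \<le> d \<longrightarrow> (condA d' \<longleftrightarrow> (\<exists>\<alpha>. condB d' \<alpha>)))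
      \<and> (\<forall>d' \<alpha>. 1 \<le> d' \<and> d' \<le> d \<and> condB d' \<alpha> \<longrightarrow>
            (\<forall>i<M1. vv \<alpha> i \<in> carrier_vec d' \<and> vv \<alpha> i \<bullet> vv \<alpha> i = 1) \<and>
            (\<forall>j<M2. ww \<alpha> j \<in> carrier_vec d' \<and> ww \<alpha> j \<bullet> ww \<alpha> j = 1) \<and>
            (\<Sum>i<M1. \<Sum>j<M2. g $$ (i, j) * (vv \<alpha> i \<bullet> ww \<alpha> j)) = sqrt (real (M1 * M2)) * \<sigma>)
      \<and> ((\<exists>n1 n2 \<rho> A1 A2. quantum_strategy M1 M2 n1 n2 \<rho> A1 A2 \<and>
            (\<Sum>i<M1. \<Sum>j<M2. complex_of_real (g $$ (i, j)) * correlator \<rho> (A1 i) (A2 j))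
              = complex_of_real (sqrt (real (M1 * M2)) * \<sigma>))
         \<longleftrightarrow> (\<exists>d' \<alpha>. 1 \<le> d' \<and> d' \<le> d \<and> condB d' \<alpha>))
      \<and> (\<forall>d' \<alpha>. 1 \<le> d' \<and> d' \<le> d \<and> condB d' \<alpha> \<longrightarrow>
            (\<exists>n1 n2 \<rho> A1 A2. quantum_strategy M1 M2 n1 n2 \<rho> A1 A2 \<and>
               (\<forall>i<M1. \<forall>j<M2. correlator \<rho> (A1 i) (A2 j) = complex_of_real (vv \<alpha> i \<bullet> ww \<alpha> j)) \<and>
               (\<Sum>i<M1. \<Sum>j<M2. complex_of_real (g $$ (i, j)) * correlator \<rho> (A1 i) (A2 j))
                 = complex_of_real (sqrt (real (M1 * M2)) * \<sigma>)))"
  proof (intro conjI)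
    show "\<forall>d'. 1 \<le> d' \<and> d' \<le> d \<longrightarrow> (condA d' \<longleftrightarrow> (\<exists>\<alpha>. condB d' \<alpha>))" using part1 by simp
  next
    show "(\<exists>n1 n2 \<rho> A1 A2. quantum_strategy M1 M2 n1 n2 \<rho> A1 A2 \<and>
            (\<Sum>i<M1. \<Sum>j<M2. complex_of_real (g $$ (i, j)) * correlator \<rho> (A1 i) (A2 j))
              = complex_of_real (sqrt (real (M1 * M2)) * \<sigma>))
         \<longleftrightarrow> (\<exists>d' \<alpha>. 1 \<le> d' \<and> d' \<le> d \<and> condB d' \<alpha>)"
      using part3 part4 by meson
  qed (use strong part4 in blast)+
  then show ?thesis unfolding Let_def defs .
qed

end
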